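(* Let $X$ be a Banach space with the Radon-Nikodým property and let $G \subseteq \mathcal{L}(X)$ be a compact group of isometries. Then $X$ has the $G$-Bishop-Phelps property.
   Context: Banach spaces are over $\mathbb{K}\in\{\mathbb{R},\mathbb{C}\}$. $\mathcal{L}(X,Y)$ is the space of bounded linear operators from $X$ to $Y$ with the operator norm, and $\mathcal{L}(X)=\mathcal{L}(X,X)$. A group $G\subseteq\mathcal{L}(X)$ is a group (under composition) of invertible bounded linear maps on $X$, endowed with the relative topology of $\mathcal{L}(X)$ (operator norm); "compact" refers to this topology. "Group of isometries" means that every $g\in G$ is an isometric isomorphism of $X$. An operator $T\in\mathcal{L}(X,Y)$ is $G$-invariant if $T(g(x))=T(x)$ for all $x\in X$, $g\in G$; $\mathcal{L}_G(X,Y)$ is the set of $G$-invariant operators in $\mathcal{L}(X,Y)$. A set $C\subseteq X$ is $G$-invariant if $g(C)\subseteq C$ for every $g\in G$. An operator $T$ attains its supremum on $C$ if there is $x_0\in C$ with $\|T(x_0)\|=\sup_{x\in C}\|T(x)\|$. The space $X$ has the $G$-Bishop-Phelps property if for every Banach space $Y$ and for every non-empty closed, absolutely convex, bounded set $C\subseteq X$ that is $G$-invariant, the set of $G$-invariant operators from $X$ into $Y$ that attain their supremum on $C$ is norm dense in $\mathcal{L}_G(X,Y)$. *)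

theory Defs
  imports "HOL-Analysis.Analysis"
begin

section \<open>Scalars and normed spaces over them\<close>

text \<open>The image of the embedding \<open>\<phi>\<close> is a subfield of the complex numbers containing the reals, so a type
  of this class is, up to isometric isomorphism, one of the two fields \<open>real\<close> and \<open>complex\<close>.\<close>

class real_or_complex = real_normed_field +
  assumes complex_embedding:
    "\<exists>\<phi> :: 'a \<Rightarrow> complex.
       (\<forall>x y. \<phi> (x + y) = \<phi> x + \<phi> y) \<and> (\<forall>r x. \<phi> (r *\<^sub>R x) = r *\<^sub>R \<phi> x) \<and>
       (\<forall>x y. \<phi> (x * y) = \<phi> x * \<phi> y) \<and> (\<forall>x. norm (\<phi> x) = norm x)"

instance real :: real_or_complex
proof
  show "\<exists>\<phi> :: real \<Rightarrow> complex.
       (\<forall>x y. \<phi> (x + y) = \<phi> x + \<phi> y) \<and> (\<forall>r x. \<phi> (r *\<^sub>R x) = r *\<^sub>R \<phi> x) \<and>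
       (\<forall>x y. \<phi> (x * y) = \<phi> x * \<phi> y) \<and> (\<forall>x. norm (\<phi> x) = norm x)"
    by (intro exI [of _ complex_of_real]) (simp add: scaleR_conv_of_real)
qed

instance complex :: real_or_complex
proof
  show "\<exists>\<phi> :: complex \<Rightarrow> complex.
       (\<forall>x y. \<phi> (x + y) = \<phi> x + \<phi> y) \<and> (\<forall>r x. \<phi> (r *\<^sub>R x) = r *\<^sub>R \<phi> x) \<and>
       (\<forall>x y. \<phi> (x * y) = \<phi> x * \<phi> y) \<and> (\<forall>x. norm (\<phi> x) = norm x)"
    by (intro exI [of _ "\<lambda>x. x"]) simp
qed

text \<open>The library has no complex normed spaces. The type carries the norm and the real structure
  underlying the space; the scalar multiplication by the field \<open>'k\<close> is the extra datum. For
  \<open>'k = real\<close> it is forced to be \<^const>\<open>scaleR\<close>. A Banach space is the case where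
  the type is of class \<^class>\<open>banach\<close>.\<close>

locale normed_space_over = vector_space smul
  for smul :: "'k::real_or_complex \<Rightarrow> 'a::real_normed_vector \<Rightarrow> 'a" +
  assumes smul_of_real: "smul (of_real r) x = r *\<^sub>R x"
    and norm_smul: "norm (smul c x) = norm c * norm x"

lemma normed_space_over_scaleR:
  "normed_space_over (scaleR :: real \<Rightarrow> 'a::real_normed_vector \<Rightarrow> 'a)"
  by unfold_locales (simp_all add: scaleR_add_right scaleR_add_left)

lemma normed_space_over_real_unique:
  assumes "normed_space_over (s :: real \<Rightarrow> 'a::real_normed_vector \<Rightarrow> 'a)"
  shows "s = scaleR"
  using normed_space_over.smul_of_real [OF assms] by (intro ext) simp

lemma normed_space_over_complex:
  "normed_space_over ((*) :: complex \<Rightarrow> complex \<Rightarrow> complex)"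
  by unfold_locales (simp_all add: algebra_simps scaleR_conv_of_real norm_mult)

definition absolutely_convex :: "('k::real_or_complex \<Rightarrow> 'a::real_normed_vector \<Rightarrow> 'a) \<Rightarrow> 'a set \<Rightarrow> bool" where
  "absolutely_convex smul C \<longleftrightarrow>
     (\<forall>x\<in>C. \<forall>y\<in>C. \<forall>a b. norm a + norm b \<le> 1 \<longrightarrow> smul a x + smul b y \<in> C)"

text \<open>The library type of bounded linear maps consists of the real-linear ones. Its norm is the
  operator norm, which does not depend on the scalar field.\<close>

definition bounded_operators ::
  "('k::real_or_complex \<Rightarrow> 'a::real_normed_vector \<Rightarrow> 'a) \<Rightarrow> ('k \<Rightarrow> 'b::real_normed_vector \<Rightarrow> 'b) \<Rightarrow> ('a \<Rightarrow>\<^sub>L 'b) set" where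
  "bounded_operators scaleX scaleY = {T. Vector_Spaces.linear scaleX scaleY (blinfun_apply T)}"


section \<open>The Radon-Nikodym property\<close>

text \<open>The library's \<^const>\<open>has_bochner_integral\<close> is restricted to second countable target spaces.
  This is the same definition for an arbitrary normed space. The approximation by simple functions
  in mean forces \<open>f\<close> to be almost everywhere separably valued, so Borel measurability amounts to strong
  measurability.\<close>

definition has_vector_integral :: "'m measure \<Rightarrow> ('m \<Rightarrow> 'a::real_normed_vector) \<Rightarrow> 'a \<Rightarrow> bool" where
  "has_vector_integral M f I \<longleftrightarrow>
     f \<in> borel_measurable M \<and>
     (\<exists>s. (\<forall>i. Bochner_Integration.simple_bochner_integrable M (s i)) \<and>
          (\<lambda>i::nat. \<integral>\<^sup>+ x. ennreal (norm (f x - s i x)) \<partial>M) \<longlonglongrightarrow> 0 \<and>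
          (\<lambda>i. Bochner_Integration.simple_bochner_integral M (s i)) \<longlonglongrightarrow> I)"

lemma has_vector_integral_iff_has_bochner_integral:
  fixes f :: "'m \<Rightarrow> 'a::{real_normed_vector, second_countable_topology}"
  shows "has_vector_integral M f I \<longleftrightarrow> has_bochner_integral M f I"
  by (auto simp: has_vector_integral_def has_bochner_integral.simps)

definition vector_measure :: "'m measure \<Rightarrow> ('m set \<Rightarrow> 'a::real_normed_vector) \<Rightarrow> bool" where
  "vector_measure M \<nu> \<longleftrightarrow>
     (\<forall>A :: nat \<Rightarrow> 'm set. range A \<subseteq> sets M \<longrightarrow> disjoint_family A \<longrightarrow> (\<lambda>i. \<nu> (A i)) sums \<nu> (\<Union>i. A i))"

definition of_bounded_variation :: "'m measure \<Rightarrow> ('m set \<Rightarrow> 'a::real_normed_vector) \<Rightarrow> bool" where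
  "of_bounded_variation M \<nu> \<longleftrightarrow>
     (\<exists>K. \<forall>P. finite P \<longrightarrow> P \<subseteq> sets M \<longrightarrow> partition_on (space M) P \<longrightarrow> (\<Sum>E\<in>P. norm (\<nu> E)) \<le> K)"

definition abs_continuous :: "'m measure \<Rightarrow> ('m set \<Rightarrow> 'a::real_normed_vector) \<Rightarrow> bool" where
  "abs_continuous M \<nu> \<longleftrightarrow> (\<forall>E \<in> null_sets M. \<nu> E = 0)"

definition radon_nikodym_for :: "'m measure \<Rightarrow> 'a::banach itself \<Rightarrow> bool" where
  "radon_nikodym_for M TYPE('a) \<longleftrightarrow>
     (\<forall>\<nu> :: 'm set \<Rightarrow> 'a. vector_measure M \<nu> \<and> of_bounded_variation M \<nu> \<and> abs_continuous M \<nu> \<longrightarrow>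
        (\<exists>f. \<forall>E \<in> sets M. has_vector_integral M (\<lambda>x. indicator E x *\<^sub>R f x) (\<nu> E)))"

text \<open>A formula cannot quantify over the type of the points of a measure space, so the finite
  measure spaces range over all sigma-algebras on all sets of real numbers. This loses nothing:
  they include Lebesgue measure on the unit interval, and the property for that one measure
  space already yields it for every finite measure space. The property does not depend on the scalar
  field.\<close>

definition radon_nikodym_property :: "'a::banach itself \<Rightarrow> bool" where
  "radon_nikodym_property TYPE('a) \<longleftrightarrow>
     (\<forall>M :: real measure. finite_measure M \<longrightarrow> radon_nikodym_for M TYPE('a))"


section \<open>Groups of operators and the Bishop-Phelps property\<close>

definition operator_group ::
  "('k::real_or_complex \<Rightarrow> 'a::real_normed_vector \<Rightarrow> 'a) \<Rightarrow> ('a \<Rightarrow>\<^sub>L 'a) set \<Rightarrow> bool" where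
  "operator_group smul G \<longleftrightarrow>
     G \<subseteq> bounded_operators smul smul \<and>
     id_blinfun \<in> G \<and>
     (\<forall>g\<in>G. \<forall>h\<in>G. g o\<^sub>L h \<in> G) \<and>
     (\<forall>g\<in>G. \<exists>h\<in>G. g o\<^sub>L h = id_blinfun \<and> h o\<^sub>L g = id_blinfun)"

text \<open>Surjectivity of the members is part of \<^const>\<open>operator_group\<close>.\<close>

definition isometry_group ::
  "('k::real_or_complex \<Rightarrow> 'a::real_normed_vector \<Rightarrow> 'a) \<Rightarrow> ('a \<Rightarrow>\<^sub>L 'a) set \<Rightarrow> bool" where
  "isometry_group smul G \<longleftrightarrow>
     operator_group smul G \<and> (\<forall>g\<in>G. \<forall>x. norm (blinfun_apply g x) = norm x)"

definition invariant_operators ::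
  "('k::real_or_complex \<Rightarrow> 'a::real_normed_vector \<Rightarrow> 'a) \<Rightarrow> ('k \<Rightarrow> 'b::real_normed_vector \<Rightarrow> 'b) \<Rightarrow>
     ('a \<Rightarrow>\<^sub>L 'a) set \<Rightarrow> ('a \<Rightarrow>\<^sub>L 'b) set" where
  "invariant_operators scaleX scaleY G =
     {T \<in> bounded_operators scaleX scaleY. \<forall>g\<in>G. \<forall>x. blinfun_apply T (blinfun_apply g x) = blinfun_apply T x}"

definition invariant_set :: "('a::real_normed_vector \<Rightarrow>\<^sub>L 'a) set \<Rightarrow> 'a set \<Rightarrow> bool" where
  "invariant_set G C \<longleftrightarrow> (\<forall>g\<in>G. blinfun_apply g ` C \<subseteq> C)"

definition attains_supremum_on ::
  "('a::real_normed_vector \<Rightarrow>\<^sub>L 'b::real_normed_vector) \<Rightarrow> 'a set \<Rightarrow> bool" where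
  "attains_supremum_on T C \<longleftrightarrow>
     (\<exists>x0\<in>C. norm (blinfun_apply T x0) = (SUP x\<in>C. norm (blinfun_apply T x)))"

text \<open>The type \<open>'b\<close> together with \<open>scaleY\<close> is the Banach space \<open>Y\<close> of the definition. All \<open>scaleY\<close> are
  quantified here; the quantification over the type \<open>'b\<close> is that of the theorem stating
  the property with \<open>'b\<close> as a free type variable.\<close>

definition G_bishop_phelps_property ::
  "('k::real_or_complex \<Rightarrow> 'a::banach \<Rightarrow> 'a) \<Rightarrow> ('a \<Rightarrow>\<^sub>L 'a) set \<Rightarrow> 'b::banach itself \<Rightarrow> bool" where
  "G_bishop_phelps_property scaleX G TYPE('b) \<longleftrightarrow>
     (\<forall>(scaleY :: 'k \<Rightarrow> 'b \<Rightarrow> 'b) C.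
        normed_space_over scaleY \<longrightarrow>
        C \<noteq> {} \<longrightarrow> closed C \<longrightarrow> absolutely_convex scaleX C \<longrightarrow> bounded C \<longrightarrow> invariant_set G C \<longrightarrow>
        invariant_operators scaleX scaleY G
          \<subseteq> closure {T \<in> invariant_operators scaleX scaleY G. attains_supremum_on T C})"

end

theory Submission
  imports Defs
begin

text \<open>
  Averaging over the group removes the group from the problem. A compact group \<open>G\<close> of isometries acts
  by right composition on the closed convex hull of \<open>G\<close> in the space of operators, which is compact; by
  Kakutani's theorem this action has a fixed point \<open>Q\<close> (\<open>averaging_operator\<close>). Then \<open>T \<circ> Q = T\<close> for
  every invariant \<open>T\<close>, the operator \<open>S \<circ> Q\<close> is invariant for every \<open>S\<close>, and \<open>Q\<close> is a
  projection of norm at most one, mapping \<open>C\<close> onto a closed balanced set \<open>D \<subseteq> C\<close>. So it suffices to approximate \<open>T\<close> by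
  operators \<open>S\<close> that attain their supremum on \<open>D\<close>, and to pass to \<open>S \<circ> Q\<close>: this is Bourgain's theorem
  that a space with the Radon-Nikodym property has the Bishop-Phelps property.

  Following Stegall, one perturbs the function \<open>\<phi> x = norm (T x)\<close> by a small functional \<open>y\<close> so that
  \<open>\<phi> + y\<close> attains its maximum on \<open>D\<close>, at \<open>x\<^sub>0\<close> say; adding to \<open>T\<close> a rank-one operator built from \<open>y\<close> and the
  direction of \<open>T x\<^sub>0\<close> then produces \<open>S\<close> (\<open>norm_attaining_perturbation\<close>). By Baire's theorem in the dual
  space, such a \<open>y\<close> exists as soon as arbitrarily small perturbations of every bounded \<open>\<phi>\<close> have
  slices \<open>{x \<in> D. \<phi> x + y x > \<beta>}\<close> of arbitrarily small diameter
  (\<open>Stegall_variational_principle\<close>).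

  The Radon-Nikodym property enters in \<open>RNP_small_slice\<close>. Suppose that for all \<open>y\<close> with norm at most
  \<open>\<epsilon>\<close> every slice has diameter at least \<open>\<delta>\<close>. The sandwich form of the Hahn-Banach theorem
  (\<open>sandwich_theorem\<close>) then shows that each \<open>x \<in> D\<close> is close to an average of points of \<open>D\<close> at
  distance at least \<open>\<delta> / 2\<close> from \<open>x\<close>, where the error of the average, multiplied by \<open>\<epsilon>\<close>, is paid for by an increase of
  the mean of \<open>\<phi>\<close>. Iteration gives step functions on the unit interval, one for each of a sequence of
  dyadic partitions, which jump by at least \<open>\<delta> / 2\<close> everywhere from one to the next and which
  form a martingale up to errors whose sum is finite, because \<open>\<phi>\<close> is bounded. Their integrals converge
  setwise to a vector measure of bounded variation, absolutely continuous with respect to Lebesgue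
  measure, and the step functions converge in mean to its density. This contradicts the jumps
  (\<open>RNP_increments_small\<close>).
\<close>

section \<open>Averaging over a compact group of isometries\<close>

text \<open>In a Banach space total boundedness is what has to be checked, and it passes from a finite net of
  \<open>S\<close> to the convex hull of that net, which is compact, and thence to the convex hull of
  \<open>S\<close>.\<close>

lemma compact_closure_convex_hull:
  fixes S :: "'v::banach set"
  assumes "compact S"
  shows "compact (closure (convex hull S))"
  unfolding compact_eq_totally_bounded
proof (intro conjI allI impI)
  show "complete (closure (convex hull S))"
    by (simp add: complete_eq_closed)
  fix e :: real assume e: "0 < e"
  then have e3: "0 < e / 3" by simp
  then obtain F where F: "finite F" "S \<subseteq> (\<Union>x\<in>F. ball x (e / 3))"
    using seq_compact_imp_totally_bounded[OF compact_imp_seq_compact[OF assms]] by blast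
  have "compact (convex hull F)"
    using F by (simp add: finite_imp_compact_convex_hull)
  from seq_compact_imp_totally_bounded[OF compact_imp_seq_compact[OF this], rule_format, OF e3]
  obtain k where k: "finite k" "convex hull F \<subseteq> (\<Union>x\<in>k. ball x (e / 3))"
    by blast
  define N where "N = (\<Union>x\<in>convex hull F. \<Union>y\<in>ball 0 (e / 3). {x + y})"
  have "convex hull S \<subseteq> N"
  proof (rule hull_minimal)
    show "convex N"
      unfolding N_def by (intro convex_sums convex_convex_hull convex_ball)
    show "S \<subseteq> N"
    proof
      fix s assume "s \<in> S"
      with F obtain x where "x \<in> F" "dist x s < e / 3" by auto
      then have "x \<in> convex hull F" "s - x \<in> ball 0 (e / 3)" "s = x + (s - x)"
        by (auto simp: hull_inc dist_norm norm_minus_commute)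
      then show "s \<in> N"
        unfolding N_def by blast
    qed
  qed
  have "closure (convex hull S) \<subseteq> (\<Union>x\<in>k. ball x e)"
  proof
    fix z assume "z \<in> closure (convex hull S)"
    then obtain z' where z': "z' \<in> convex hull S" "dist z' z < e / 3"
      using e3 unfolding closure_approachable by blast
    with \<open>convex hull S \<subseteq> N\<close> obtain x y where xy: "x \<in> convex hull F" "norm y < e / 3" "z' = x + y"
      by (auto simp: N_def)
    with k obtain c where c: "c \<in> k" "dist c x < e / 3" by auto
    have "dist c z \<le> dist c x + dist x z' + dist z' z"
      using dist_triangle[of c z z'] dist_triangle[of c z' x] by simp
    also have "dist x z' = norm y"
      using xy by (simp add: dist_norm)
    finally have "dist c z < e"
      using c xy z' by simp
    with c show "z \<in> (\<Union>x\<in>k. ball x e)" by auto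
  qed
  with k show "\<exists>k. finite k \<and> closure (convex hull S) \<subseteq> (\<Union>x\<in>k. ball x e)"
    by blast
qed

text \<open>The mean \<open>u\<close> of a finite net \<open>F\<close> of mesh \<open>diameter L / 2\<close> is central:
  every point of \<open>L\<close> is within half the diameter of one member of \<open>F\<close> and within the
  diameter of the others, so its distance to \<open>u\<close> falls short of the diameter by at least
  \<open>diameter L / (2 * card F)\<close>.\<close>

lemma compact_convex_has_central_point:
  fixes L :: "'v::real_normed_vector set"
  assumes L: "compact L" "convex L" and "a \<in> L" "b \<in> L" "a \<noteq> b"
  obtains u r where "u \<in> L" "L \<subseteq> cball u r" "r < diameter L"
proof -
  define d where "d = diameter L"
  have dist_le: "dist x y \<le> d" if "x \<in> L" "y \<in> L" for x y
    unfolding d_def using that compact_imp_bounded[OF L(1)] by (rule diameter_bounded_bound[rotated])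
  have d: "0 < d"
    using dist_le[of a b] assms zero_less_dist_iff[of a b] by linarith
  then obtain F where F: "finite F" "F \<subseteq> L" "L \<subseteq> (\<Union>x\<in>F. ball x (d / 2))"
    using seq_compact_imp_totally_bounded[OF compact_imp_seq_compact[OF L(1)], rule_format, of "d / 2"]
    by auto
  then have "F \<noteq> {}" using assms by auto
  define n where "n = real (card F)"
  have n: "0 < n" unfolding n_def using F \<open>F \<noteq> {}\<close> by (simp add: card_gt_0_iff)
  define u where "u = (\<Sum>f\<in>F. (1 / n) *\<^sub>R f)"
  have "u \<in> L"
    unfolding u_def
    by (rule convex_sum) (use F L n in \<open>auto simp: n_def\<close>)
  moreover have "L \<subseteq> cball u (d - d / (2 * n))"
  proof
    fix x assume x: "x \<in> L"
    with F obtain f0 where f0: "f0 \<in> F" "dist f0 x < d / 2" by auto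
    have card: "real (card (F - {f0})) = n - 1"
      using F f0 card_Suc_Diff1[of F f0] by (simp add: n_def)
    have "u - x = (\<Sum>f\<in>F. (1 / n) *\<^sub>R (f - x))"
      using n by (simp add: u_def scaleR_diff_right sum_subtractf sum_constant_scaleR n_def)
    then have "norm (u - x) \<le> (\<Sum>f\<in>F. norm ((1 / n) *\<^sub>R (f - x)))"
      by (metis norm_sum)
    also have "\<dots> = (\<Sum>f\<in>F. dist f x) / n"
      using n by (simp add: dist_norm sum_divide_distrib)
    also have "(\<Sum>f\<in>F. dist f x) = dist f0 x + (\<Sum>f\<in>F - {f0}. dist f x)"
      using F f0 by (simp add: sum.remove)
    also have "\<dots> \<le> d / 2 + (\<Sum>f\<in>F - {f0}. d)"
      using f0 F x by (intro add_mono sum_mono dist_le) auto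
    also have "\<dots> = d / 2 + (n - 1) * d"
      unfolding card[symmetric] by simp
    also have "\<dots> = (n - 1 / 2) * d"
      by (simp add: field_simps)
    finally have "norm (u - x) \<le> (n - 1 / 2) * d / n"
      using n by (simp add: divide_right_mono)
    also have "\<dots> = d - d / (2 * n)"
      using n by (simp add: field_simps)
    finally show "x \<in> cball u (d - d / (2 * n))"
      by (simp add: dist_norm)
  qed
  moreover have "d - d / (2 * n) < d"
    using d n by simp
  ultimately show ?thesis
    unfolding d_def by (rule that)
qed

text \<open>A minimal nonempty closed convex invariant set \<open>L\<close> is a singleton. Otherwise it has a central
  point within some \<open>r < diameter L\<close> of all of \<open>L\<close>, and the points of \<open>L\<close>
  with this property form a smaller invariant set. The right inverses in \<open>\<Gamma>\<close> are what makes
  that set invariant.\<close>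

theorem Kakutani_fixed_point:
  fixes K :: "'v::real_normed_vector set" and \<Gamma> :: "('v \<Rightarrow> 'v) set"
  assumes K: "compact K" "convex K" "K \<noteq> {}"
    and inv_K: "\<And>\<gamma>. \<gamma> \<in> \<Gamma> \<Longrightarrow> \<gamma> ` K \<subseteq> K"
    and isom: "\<And>\<gamma> x y. \<gamma> \<in> \<Gamma> \<Longrightarrow> dist (\<gamma> x) (\<gamma> y) = dist x y"
    and right_inv: "\<And>\<gamma>. \<gamma> \<in> \<Gamma> \<Longrightarrow> \<exists>\<gamma>'\<in>\<Gamma>. \<forall>x. \<gamma> (\<gamma>' x) = x"
  obtains p where "p \<in> K" "\<And>\<gamma>. \<gamma> \<in> \<Gamma> \<Longrightarrow> \<gamma> p = p"
proof -
  define S where "S = {L. L \<subseteq> K \<and> L \<noteq> {} \<and> closed L \<and> convex L \<and> (\<forall>\<gamma>\<in>\<Gamma>. \<gamma> ` L \<subseteq> L)}"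
  have "\<exists>L\<in>S. \<forall>M\<in>S. L \<supseteq> M \<longrightarrow> M = L"
  proof (rule predicate_Zorn[where P = "\<lambda>A B. A \<supseteq> B"])
    show "partial_order_on S (relation_of (\<lambda>A B. B \<subseteq> A) S)"
      by (rule partial_order_on_relation_ofI) auto
    fix C assume C: "C \<in> Chains (relation_of (\<lambda>A B. B \<subseteq> A) S)"
    then have CS: "C \<subseteq> S" and chain: "\<And>A B. A \<in> C \<Longrightarrow> B \<in> C \<Longrightarrow> A \<subseteq> B \<or> B \<subseteq> A"
      by (auto simp: Chains_def relation_of_def)
    show "\<exists>U\<in>S. \<forall>A\<in>C. U \<subseteq> A"
    proof (cases "C = {}")
      case True
      have "K \<in> S" using K inv_K by (auto simp: S_def compact_imp_closed)
      then show ?thesis using True by blast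
    next
      case False
      have "K \<inter> \<Inter>C \<noteq> {}"
      proof (rule compact_imp_fip[OF K(1)])
        show "closed A" if "A \<in> C" for A
          using that CS by (auto simp: S_def)
        fix B assume B: "finite B" "B \<subseteq> C"
        show "K \<inter> \<Inter>B \<noteq> {}"
        proof (cases "B = {}")
          case nonempty: False
          with finite_has_minimal[OF B(1)] obtain m where m: "m \<in> B" "\<And>b. b \<in> B \<Longrightarrow> b \<subseteq> m \<Longrightarrow> m = b"
            by blast
          then have "m \<subseteq> b" if "b \<in> B" for b
            using chain[of m b] B that by blast
          moreover have "m \<noteq> {}" "m \<subseteq> K"
            using m B CS by (auto simp: S_def)
          ultimately show ?thesis by blast
        qed (use K in auto)
      qed
      then have "\<Inter>C \<noteq> {}" by blast
      moreover have "closed (\<Inter>C)" "convex (\<Inter>C)"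
        using CS by (auto simp: S_def intro!: closed_Inter convex_Inter)
      moreover have "\<Inter>C \<subseteq> K" "\<forall>\<gamma>\<in>\<Gamma>. \<gamma> ` \<Inter>C \<subseteq> \<Inter>C"
        using CS False by (fastforce simp: S_def)+
      ultimately show ?thesis
        by (intro bexI[of _ "\<Inter>C"]) (auto simp: S_def)
    qed
  qed
  then obtain L where L: "L \<in> S" and minimal: "\<And>M. M \<in> S \<Longrightarrow> M \<subseteq> L \<Longrightarrow> M = L"
    by blast
  then have L': "L \<subseteq> K" "L \<noteq> {}" "closed L" "convex L" "\<And>\<gamma> x. \<gamma> \<in> \<Gamma> \<Longrightarrow> x \<in> L \<Longrightarrow> \<gamma> x \<in> L"
    unfolding S_def by blast+
  have cL: "compact L"
    using K(1) L' compact_Int_closed[of K L] by (simp add: Int_absorb1)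
  have single: "a = b" if ab: "a \<in> L" "b \<in> L" for a b
  proof (rule ccontr)
    assume "a \<noteq> b"
    with cL L'(4) ab obtain u r where u: "u \<in> L" "L \<subseteq> cball u r" and r: "r < diameter L"
      by (rule compact_convex_has_central_point)
    define M where "M = L \<inter> (\<Inter>x\<in>L. cball x r)"
    have "M \<in> S"
      unfolding S_def
    proof (intro CollectI conjI ballI)
      show "M \<subseteq> K" using L' by (auto simp: M_def)
      have "u \<in> M" using u by (auto simp: M_def dist_commute subset_eq)
      then show "M \<noteq> {}" by blast
      show "closed M" using L' by (auto simp: M_def)
      show "convex M" using L' by (auto simp: M_def intro!: convex_Int convex_INT)
      fix \<gamma> assume \<gamma>: "\<gamma> \<in> \<Gamma>"
      with right_inv obtain \<gamma>' where \<gamma>': "\<gamma>' \<in> \<Gamma>" "\<And>x. \<gamma> (\<gamma>' x) = x" by blast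
      show "\<gamma> ` M \<subseteq> M"
      proof (rule image_subsetI)
        fix x assume x: "x \<in> M"
        have "dist z (\<gamma> x) \<le> r" if "z \<in> L" for z
        proof -
          have "dist (\<gamma>' z) x \<le> r"
            using x L'(5)[OF \<gamma>'(1) that] by (auto simp: M_def)
          with isom[OF \<gamma>, of "\<gamma>' z" x] \<gamma>' show ?thesis by simp
        qed
        with x L'(5)[OF \<gamma>] show "\<gamma> x \<in> M" by (auto simp: M_def)
      qed
    qed
    then have "M = L"
      by (intro minimal) (auto simp: M_def)
    then have "dist x y \<le> r" if "x \<in> L" "y \<in> L" for x y
      using that unfolding M_def by (metis INT_iff Int_iff mem_cball)
    then have "diameter L \<le> r"
      using L'(2) by (intro diameter_le) (auto simp: dist_norm)
    with r show False by simp
  qed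
  from L'(2) obtain p where p: "p \<in> L" by blast
  show ?thesis
  proof (rule that[of p])
    show "p \<in> K" using p L' by blast
    show "\<gamma> p = p" if "\<gamma> \<in> \<Gamma>" for \<gamma>
      using single[OF L'(5)[OF that p] p] .
  qed
qed

text \<open>The average of \<open>G\<close> with respect to Haar measure would serve as \<open>Q\<close>. It is obtained
  here without the measure, as a common fixed point of the right translations, which are isometries of the space
  of operators because the members of \<open>G\<close> are surjective isometries.\<close>

theorem averaging_operator:
  fixes G :: "('a::banach \<Rightarrow>\<^sub>L 'a) set"
  assumes G: "compact G" "isometry_group smul G"
  obtains Q where "Q \<in> closure (convex hull G)" "\<And>g. g \<in> G \<Longrightarrow> Q o\<^sub>L g = Q"
proof -
  have grp: "id_blinfun \<in> G" "\<And>g h. g \<in> G \<Longrightarrow> h \<in> G \<Longrightarrow> g o\<^sub>L h \<in> G"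
    "\<And>g. g \<in> G \<Longrightarrow> \<exists>h\<in>G. g o\<^sub>L h = id_blinfun \<and> h o\<^sub>L g = id_blinfun"
    and iso: "\<And>g x. g \<in> G \<Longrightarrow> norm (blinfun_apply g x) = norm x"
    using G(2) by (auto simp: isometry_group_def operator_group_def)
  let ?K = "closure (convex hull G)"
  let ?\<Gamma> = "(\<lambda>g (A :: 'a \<Rightarrow>\<^sub>L 'a). A o\<^sub>L g) ` G"
  have lin: "bounded_linear (\<lambda>A :: 'a \<Rightarrow>\<^sub>L 'a. A o\<^sub>L g)" for g :: "'a \<Rightarrow>\<^sub>L 'a"
    by (rule bounded_bilinear.bounded_linear_left[OF bounded_bilinear_blinfun_compose])
  have norm_le: "norm (A o\<^sub>L g) \<le> norm A" if "g \<in> G" for g and A :: "'a \<Rightarrow>\<^sub>L 'a"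
  proof (rule norm_blinfun_bound)
    fix x show "norm (blinfun_apply (A o\<^sub>L g) x) \<le> norm A * norm x"
      using norm_blinfun[of A "blinfun_apply g x"] iso[OF that] by simp
  qed simp
  have inv: "\<exists>h\<in>G. \<forall>A. (A o\<^sub>L h) o\<^sub>L g = A \<and> (A o\<^sub>L g) o\<^sub>L h = A" if g: "g \<in> G" for g
  proof -
    from grp(3)[OF g] obtain h where h: "h \<in> G" "g o\<^sub>L h = id_blinfun" "h o\<^sub>L g = id_blinfun"
      by blast
    have "blinfun_apply g (blinfun_apply h x) = x" "blinfun_apply h (blinfun_apply g x) = x" for x
      using h by (metis blinfun_apply_blinfun_compose id_blinfun.rep_eq id_apply)+
    with h(1) show ?thesis
      by (intro bexI[of _ h]) (auto intro!: blinfun_eqI)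
  qed
  have isom: "norm (A o\<^sub>L g) = norm A" if g: "g \<in> G" for g and A :: "'a \<Rightarrow>\<^sub>L 'a"
  proof (rule antisym)
    from inv[OF g] obtain h where "h \<in> G" "(A o\<^sub>L g) o\<^sub>L h = A" by blast
    with norm_le[of h "A o\<^sub>L g"] show "norm A \<le> norm (A o\<^sub>L g)" by simp
  qed (rule norm_le[OF g])
  obtain Q where "Q \<in> ?K" "\<And>\<gamma>. \<gamma> \<in> ?\<Gamma> \<Longrightarrow> \<gamma> Q = Q"
  proof (rule Kakutani_fixed_point[of ?K ?\<Gamma>])
    show "compact ?K" using G(1) by (rule compact_closure_convex_hull)
    show "convex ?K" by (simp add: convex_closure)
    show "?K \<noteq> {}" using grp(1) by auto
    fix \<gamma> assume "\<gamma> \<in> ?\<Gamma>"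
    then obtain g where g: "g \<in> G" "\<gamma> = (\<lambda>A. A o\<^sub>L g)" by blast
    have "\<gamma> ` (convex hull G) = convex hull (\<gamma> ` G)"
      unfolding g(2) by (rule convex_hull_linear_image[OF bounded_linear.linear[OF lin]])
    also have "\<dots> \<subseteq> convex hull G"
      using g grp(2) by (intro hull_mono) auto
    finally have "closure (\<gamma> ` (convex hull G)) \<subseteq> ?K"
      by (rule closure_mono)
    then show "\<gamma> ` ?K \<subseteq> ?K"
      using closure_bounded_linear_image_subset[OF lin, of g "convex hull G"] g by blast
    show "dist (\<gamma> x) (\<gamma> y) = dist x y" for x y
      using isom[OF g(1), of "x - y"] linear_diff[OF bounded_linear.linear[OF lin[of g]], of x y]
      by (simp add: g(2) dist_norm)
    show "\<exists>\<gamma>'\<in>?\<Gamma>. \<forall>x. \<gamma> (\<gamma>' x) = x"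
      using inv[OF g(1)] g(2) by auto
  qed blast
  then show ?thesis
    by (intro that) auto
qed

section \<open>The sandwich theorem\<close>

text \<open>The inequality for positive \<open>c\<close> is easier to verify for infima than positive homogeneity, which
  follows from it (\<open>sublinear_scaleR\<close>).\<close>

definition sublinear :: "('v::real_vector \<Rightarrow> real) \<Rightarrow> bool" where
  "sublinear q \<longleftrightarrow> (\<forall>v w. q (v + w) \<le> q v + q w) \<and> (\<forall>c>0. \<forall>v. q (c *\<^sub>R v) \<le> c * q v)"

lemma sublinear_scaleR:
  assumes "sublinear q" "0 \<le> c"
  shows "q (c *\<^sub>R v) = c * q v"
proof -
  have pos: "q (c *\<^sub>R v) = c * q v" if "0 < c" for c v
  proof (rule antisym)
    show "q (c *\<^sub>R v) \<le> c * q v"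
      using assms(1) that by (simp add: sublinear_def)
    have "q (inverse c *\<^sub>R (c *\<^sub>R v)) \<le> inverse c * q (c *\<^sub>R v)"
      using assms(1) that unfolding sublinear_def by (metis positive_imp_inverse_positive)
    then show "c * q v \<le> q (c *\<^sub>R v)"
      using that by (simp add: field_simps)
  qed
  have "q 0 = 0"
    using pos[of 2 0] by simp
  with pos[of c v] assms(2) show ?thesis
    by (cases "c = 0") auto
qed

lemma sublinear_bounded_below:
  assumes "sublinear q"
  shows "- q (- v) \<le> q v"
proof -
  have "q (v + - v) \<le> q v + q (- v)"
    using assms unfolding sublinear_def by blast
  moreover have "q 0 = 0"
    using sublinear_scaleR[OF assms, of 0 0] by simp
  ultimately show ?thesis by simp
qed

text \<open>The hypotheses \<open>dir\<close> and \<open>hom\<close> cover both chains of sublinear functionals and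
  families indexed by a convex cone, whose members need not be sublinear themselves.\<close>

lemma sublinear_Inf:
  fixes Q :: "('v::real_vector \<Rightarrow> real) set"
  assumes "Q \<noteq> {}" and lb: "\<And>q v. q \<in> Q \<Longrightarrow> b v \<le> q v"
    and dir: "\<And>q r v w. q \<in> Q \<Longrightarrow> r \<in> Q \<Longrightarrow> \<exists>s\<in>Q. s (v + w) \<le> q v + r w"
    and hom: "\<And>q c v. q \<in> Q \<Longrightarrow> c > 0 \<Longrightarrow> \<exists>s\<in>Q. s (c *\<^sub>R v) \<le> c * q v"
  shows "sublinear (\<lambda>v. INF q\<in>Q. q v)"
proof -
  have bdd: "bdd_below ((\<lambda>q. q v) ` Q)" for v
    using lb by (intro bdd_belowI2)
  have le: "(INF q\<in>Q. q v) \<le> q v" if "q \<in> Q" for q v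
    using bdd that by (rule cINF_lower)
  show ?thesis
    unfolding sublinear_def
  proof (intro conjI allI impI)
    fix v w
    have "(INF q\<in>Q. q (v + w)) - q v \<le> (INF r\<in>Q. r w)" if q: "q \<in> Q" for q
    proof (rule cINF_greatest[OF assms(1)])
      fix r assume "r \<in> Q"
      from dir[OF q this] obtain s where "s \<in> Q" "s (v + w) \<le> q v + r w"
        by blast
      with le[of s "v + w"] show "(INF q\<in>Q. q (v + w)) - q v \<le> r w"
        by simp
    qed
    then have "(INF q\<in>Q. q (v + w)) - (INF r\<in>Q. r w) \<le> (INF q\<in>Q. q v)"
      by (intro cINF_greatest[OF assms(1)]) (simp add: algebra_simps)
    then show "(INF q\<in>Q. q (v + w)) \<le> (INF q\<in>Q. q v) + (INF q\<in>Q. q w)"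
      by simp
  next
    fix c :: real and v assume c: "0 < c"
    have "(INF q\<in>Q. q (c *\<^sub>R v)) / c \<le> (INF q\<in>Q. q v)"
    proof (rule cINF_greatest[OF assms(1)])
      fix q assume "q \<in> Q"
      from hom[OF this c] obtain s where "s \<in> Q" "s (c *\<^sub>R v) \<le> c * q v"
        by blast
      with le[of s "c *\<^sub>R v"] c show "(INF q\<in>Q. q (c *\<^sub>R v)) / c \<le> q v"
        by (simp add: field_simps)
    qed
    with c show "(INF q\<in>Q. q (c *\<^sub>R v)) \<le> c * (INF q\<in>Q. q v)"
      by (simp add: field_simps)
  qed
qed

text \<open>For a fixed \<open>y\<close>, the functional \<open>v \<mapsto> INF t\<ge>0. q (v + t y) - t q y\<close> is
  sublinear and below \<open>q\<close>, so it equals \<open>q\<close>. Taking \<open>t = 1\<close> and \<open>v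
  = - y\<close> gives \<open>q (- y) \<le> - q y\<close>, and an odd sublinear functional is linear.\<close>

lemma minimal_sublinear_imp_linear:
  fixes q :: "'v::real_vector \<Rightarrow> real"
  assumes q: "sublinear q"
    and minimal: "\<And>r. sublinear r \<Longrightarrow> (\<And>v. r v \<le> q v) \<Longrightarrow> r = q"
  shows "linear q"
proof -
  note scale = sublinear_scaleR[OF q]
  have add: "q (v + w) \<le> q v + q w" for v w
    using q by (simp add: sublinear_def)
  have odd: "q (- y) = - q y" for y
  proof -
    define Q where "Q = (\<lambda>t v. q (v + t *\<^sub>R y) - t * q y) ` {0..}"
    define r where "r = (\<lambda>v. INF s\<in>Q. s v)"
    have lb: "- q (- v) \<le> s v" if "s \<in> Q" for s v
    proof -
      from that obtain t where t: "0 \<le> t" "s v = q (v + t *\<^sub>R y) - t * q y"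
        by (auto simp: Q_def)
      have "q (t *\<^sub>R y) \<le> q (v + t *\<^sub>R y) + q (- v)"
        using add[of "v + t *\<^sub>R y" "- v"] by simp
      with t scale[of t y] show ?thesis by simp
    qed
    have "sublinear r"
      unfolding r_def
    proof (rule sublinear_Inf[where b = "\<lambda>v. - q (- v)"])
      show "Q \<noteq> {}" by (simp add: Q_def)
      show "- q (- v) \<le> s v" if "s \<in> Q" for s v
        using lb that .
      show "\<exists>s\<in>Q. s (v + w) \<le> s1 v + s2 w" if "s1 \<in> Q" "s2 \<in> Q" for s1 s2 v w
      proof -
        from that obtain t1 t2 where t: "0 \<le> t1" "s1 = (\<lambda>v. q (v + t1 *\<^sub>R y) - t1 * q y)"
          "0 \<le> t2" "s2 = (\<lambda>v. q (v + t2 *\<^sub>R y) - t2 * q y)"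
          by (auto simp: Q_def)
        have "(\<lambda>v. q (v + (t1 + t2) *\<^sub>R y) - (t1 + t2) * q y) \<in> Q"
          using t by (auto simp: Q_def)
        moreover have "q (v + w + (t1 + t2) *\<^sub>R y) - (t1 + t2) * q y \<le> s1 v + s2 w"
          using add[of "v + t1 *\<^sub>R y" "w + t2 *\<^sub>R y"] t by (simp add: algebra_simps)
        ultimately show ?thesis
          by (intro bexI[of _ "\<lambda>v. q (v + (t1 + t2) *\<^sub>R y) - (t1 + t2) * q y"])
      qed
      show "\<exists>s\<in>Q. s (c *\<^sub>R v) \<le> c * s1 v" if "s1 \<in> Q" "0 < c" for s1 c v
      proof -
        from that obtain t where t: "0 \<le> t" "s1 = (\<lambda>v. q (v + t *\<^sub>R y) - t * q y)"
          by (auto simp: Q_def)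
        have "(\<lambda>v. q (v + (c * t) *\<^sub>R y) - (c * t) * q y) \<in> Q"
          using t that by (auto simp: Q_def)
        moreover have "q (c *\<^sub>R v + (c * t) *\<^sub>R y) - (c * t) * q y \<le> c * s1 v"
          using scale[of c "v + t *\<^sub>R y"] t that by (simp add: algebra_simps)
        ultimately show ?thesis
          by (intro bexI[of _ "\<lambda>v. q (v + (c * t) *\<^sub>R y) - (c * t) * q y"])
      qed
    qed
    moreover have r_le: "r v \<le> q (v + t *\<^sub>R y) - t * q y" if "0 \<le> t" for v t
    proof -
      have "(\<lambda>v. q (v + t *\<^sub>R y) - t * q y) \<in> Q"
        using that by (auto simp: Q_def)
      moreover have "bdd_below ((\<lambda>s. s v) ` Q)"
        using lb by (rule bdd_belowI2)
      ultimately show ?thesis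
        unfolding r_def using cINF_lower[of "\<lambda>s. s v" Q "\<lambda>v. q (v + t *\<^sub>R y) - t * q y"] by simp
    qed
    ultimately have "r = q"
      using r_le[of 0] by (intro minimal) auto
    with r_le[of 1 "- y"] have "q (- y) \<le> q 0 - q y"
      by simp
    moreover have "q 0 = 0"
      using scale[of 0 0] by simp
    ultimately show ?thesis
      using sublinear_bounded_below[OF q, of "- y"] by simp
  qed
  show "linear q"
  proof (rule linearI)
    fix v w
    have "q v \<le> q (v + w) + q (- w)"
      using add[of "v + w" "- w"] by simp
    with add[of v w] odd[of w] show "q (v + w) = q v + q w"
      by simp
  next
    fix c v
    show "q (c *\<^sub>R v) = c *\<^sub>R q v"
      using scale[of c v] scale[of "- c" v] odd[of "c *\<^sub>R v"] by (cases "0 \<le> c") auto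
  qed
qed

text \<open>The Hahn-Banach theorem, by Zorn's lemma applied downwards to the sublinear functionals below
  \<open>q\<close>.\<close>

theorem sublinear_dominates_linear:
  fixes q :: "'v::real_vector \<Rightarrow> real"
  assumes q: "sublinear q"
  obtains y where "linear y" "\<And>v. y v \<le> q v"
proof -
  define S where "S = {r. sublinear r \<and> (\<forall>v. r v \<le> q v)}"
  define P where "P = (\<lambda>f g :: 'v \<Rightarrow> real. \<forall>v. g v \<le> f v)"
  have lb: "- q (- v) \<le> r v" if "r \<in> S" for r v
  proof -
    have "r (- v) \<le> q (- v)" "- r (- v) \<le> r v"
      using that sublinear_bounded_below[of r v] by (auto simp: S_def)
    then show ?thesis by simp
  qed
  have "\<exists>m\<in>S. \<forall>a\<in>S. P m a \<longrightarrow> a = m"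
  proof (rule predicate_Zorn)
    show "partial_order_on S (relation_of P S)"
      by (rule partial_order_on_relation_ofI) (auto simp: P_def fun_eq_iff intro: order_trans antisym)
    fix C assume C: "C \<in> Chains (relation_of P S)"
    then have CS: "C \<subseteq> S" and chain: "\<And>f g. f \<in> C \<Longrightarrow> g \<in> C \<Longrightarrow> P f g \<or> P g f"
      by (auto simp: Chains_def relation_of_def)
    show "\<exists>u\<in>S. \<forall>a\<in>C. P a u"
    proof (cases "C = {}")
      case True
      then show ?thesis using q by (auto simp: S_def)
    next
      case False
      define u where "u = (\<lambda>v. INF r\<in>C. r v)"
      have u_le: "u v \<le> r v" if "r \<in> C" for r v
        unfolding u_def using that lb CS by (intro cINF_lower bdd_belowI2[where m = "- q (- v)"]) auto
      have "sublinear u"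
        unfolding u_def
      proof (rule sublinear_Inf[OF False, where b = "\<lambda>v. - q (- v)"])
        show "- q (- v) \<le> r v" if "r \<in> C" for r v
          using lb CS that by blast
        show "\<exists>s\<in>C. s (v + w) \<le> r1 v + r2 w" if r: "r1 \<in> C" "r2 \<in> C" for r1 r2 v w
          using chain[OF r]
        proof
          assume "P r1 r2"
          moreover have "r2 (v + w) \<le> r2 v + r2 w"
            using CS r by (auto simp: S_def sublinear_def)
          ultimately have "r2 (v + w) \<le> r1 v + r2 w"
            using \<open>P r1 r2\<close> unfolding P_def by (meson add_right_mono order_trans)
          then show ?thesis using r by blast
        next
          assume "P r2 r1"
          moreover have "r1 (v + w) \<le> r1 v + r1 w"
            using CS r by (auto simp: S_def sublinear_def)
          ultimately have "r1 (v + w) \<le> r1 v + r2 w"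
            using \<open>P r2 r1\<close> unfolding P_def by (meson add_left_mono order_trans)
          then show ?thesis using r by blast
        qed
        show "\<exists>s\<in>C. s (c *\<^sub>R v) \<le> c * r v" if "r \<in> C" "0 < c" for r c v
          using that CS by (intro bexI[of _ r]) (auto simp: S_def sublinear_def)
      qed
      moreover have "u v \<le> q v" for v
      proof -
        from False obtain r where "r \<in> C" by blast
        with CS u_le[of r v] show ?thesis
          by (auto simp: S_def intro: order_trans[of _ "r v"])
      qed
      ultimately show ?thesis
        using u_le by (intro bexI[of _ u]) (auto simp: S_def P_def)
    qed
  qed
  then obtain m where "m \<in> S" and minimal: "\<And>a. a \<in> S \<Longrightarrow> P m a \<Longrightarrow> a = m"
    by blast
  then have "linear m"
    by (intro minimal_sublinear_imp_linear) (auto simp: S_def P_def intro: order_trans[of _ "m _"])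
  with \<open>m \<in> S\<close> show ?thesis
    by (intro that[of m]) (auto simp: S_def)
qed

text \<open>A linear functional fits between the convex set \<open>H\<close> and the cone \<open>t = e * norm u\<close>
  above it. It is found below the largest sublinear functional \<open>q\<close> with \<open>q v \<le> e * norm
  v\<close> and \<open>q (- u) \<le> - t\<close> for \<open>(u, t) \<in> H\<close>; since \<open>H\<close> is
  convex, a single multiple of one point of \<open>H\<close> suffices in the infimum that describes
  \<open>q\<close>.\<close>

theorem sandwich_theorem:
  fixes H :: "('v::real_normed_vector \<times> real) set"
  assumes H: "convex H" and e: "0 \<le> e" and below: "\<And>u t. (u, t) \<in> H \<Longrightarrow> t \<le> e * norm u"
  obtains y where "linear y" "\<And>v. \<bar>y v\<bar> \<le> e * norm v" "\<And>u t. (u, t) \<in> H \<Longrightarrow> t \<le> y u"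
proof -
  define Q where "Q = insert (\<lambda>v. e * norm v) ((\<lambda>(s, u, t) v. e * norm (v + s *\<^sub>R u) - s * t) ` ({0..} \<times> H))"
  define q where "q = (\<lambda>v. INF f\<in>Q. f v)"
  have Q_cases: "f = (\<lambda>v. e * norm v) \<or> (\<exists>s u t. 0 \<le> s \<and> (u, t) \<in> H \<and> f = (\<lambda>v. e * norm (v + s *\<^sub>R u) - s * t))"
    if "f \<in> Q" for f
    using that by (auto simp: Q_def)
  have lb: "- (e * norm v) \<le> f v" if "f \<in> Q" for f v
    using Q_cases[OF that]
  proof (elim disjE exE conjE)
    fix s u t assume s: "0 \<le> s" and ut: "(u, t) \<in> H" and f: "f = (\<lambda>v. e * norm (v + s *\<^sub>R u) - s * t)"
    have "s * t \<le> s * (e * norm u)"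
      using below[OF ut] s by (rule mult_left_mono)
    also have "\<dots> = e * norm (s *\<^sub>R u)"
      using s by simp
    also have "\<dots> \<le> e * (norm (v + s *\<^sub>R u) + norm v)"
      using e norm_triangle_ineq4[of "v + s *\<^sub>R u" v] by (intro mult_left_mono) auto
    finally show ?thesis
      by (simp add: f algebra_simps)
  qed (use e in auto)
  have tri: "e * norm (a + b) \<le> e * norm a + e * norm b" for a b :: 'v
    using mult_left_mono[OF norm_triangle_ineq[of a b] e] by (simp add: algebra_simps)
  have "sublinear q"
    unfolding q_def
  proof (rule sublinear_Inf[where b = "\<lambda>v. - (e * norm v)"])
    show "Q \<noteq> {}" by (simp add: Q_def)
    show "- (e * norm v) \<le> f v" if "f \<in> Q" for f v
      using lb that .
    show "\<exists>f\<in>Q. f (c *\<^sub>R v) \<le> c * f1 v" if "f1 \<in> Q" "0 < c" for f1 c v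
      using Q_cases[OF that(1)]
    proof (elim disjE exE conjE)
      assume "f1 = (\<lambda>v. e * norm v)"
      with that show ?thesis by (intro bexI[of _ f1]) auto
    next
      fix s u t assume s: "0 \<le> s" "(u, t) \<in> H" "f1 = (\<lambda>v. e * norm (v + s *\<^sub>R u) - s * t)"
      have "norm (c *\<^sub>R v + (c * s) *\<^sub>R u) = c * norm (v + s *\<^sub>R u)"
        using that by (metis abs_of_pos norm_scaleR scaleR_add_right scaleR_scaleR)
      moreover have "(\<lambda>v. e * norm (v + (c * s) *\<^sub>R u) - (c * s) * t) \<in> Q"
        using s that by (auto simp: Q_def intro!: rev_image_eqI[where x = "(c * s, u, t)"])
      ultimately show ?thesis
        using s by (intro bexI[of _ "\<lambda>v. e * norm (v + (c * s) *\<^sub>R u) - (c * s) * t"]) (auto simp: algebra_simps)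
    qed
    show "\<exists>f\<in>Q. f (v + w) \<le> f1 v + f2 w" if f12: "f1 \<in> Q" "f2 \<in> Q" for f1 f2 v w
    proof -
      have one: "f (a + b) \<le> f a + e * norm b" if "f \<in> Q" for f a b
        using Q_cases[OF that]
      proof (elim disjE exE conjE)
        fix s u t assume "f = (\<lambda>v. e * norm (v + s *\<^sub>R u) - s * t)"
        then show ?thesis
          using tri[of "a + s *\<^sub>R u" b] by (simp add: algebra_simps)
      qed (use tri in auto)
      consider "f1 = (\<lambda>v. e * norm v)" | "f2 = (\<lambda>v. e * norm v)"
        | s1 u1 t1 s2 u2 t2 where "0 \<le> s1" "(u1, t1) \<in> H" "f1 = (\<lambda>v. e * norm (v + s1 *\<^sub>R u1) - s1 * t1)"
          "0 \<le> s2" "(u2, t2) \<in> H" "f2 = (\<lambda>v. e * norm (v + s2 *\<^sub>R u2) - s2 * t2)"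
        using Q_cases[OF f12(1)] Q_cases[OF f12(2)] by (elim disjE exE conjE) simp_all
      then show ?thesis
      proof cases
        assume "f1 = (\<lambda>v. e * norm v)"
        then show ?thesis using one[OF f12(2), of w v] f12 by (intro bexI[of _ f2]) (auto simp: add.commute)
      next
        assume "f2 = (\<lambda>v. e * norm v)"
        then show ?thesis using one[OF f12(1), of v w] f12 by (intro bexI[of _ f1]) auto
      next
        fix s1 u1 t1 s2 u2 t2
        assume f1: "0 \<le> s1" "(u1, t1) \<in> H" "f1 = (\<lambda>v. e * norm (v + s1 *\<^sub>R u1) - s1 * t1)"
          and f2: "0 \<le> s2" "(u2, t2) \<in> H" "f2 = (\<lambda>v. e * norm (v + s2 *\<^sub>R u2) - s2 * t2)"
        show ?thesis
        proof (cases "s1 + s2 = 0")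
          case True
          with f1 f2 have "s1 = 0" "s2 = 0" by auto
          then show ?thesis using f1 f2 tri by (intro bexI[of _ "\<lambda>v. e * norm v"]) (auto simp: Q_def)
        next
          case False
          define s where "s = s1 + s2"
          with False f1 f2 have s: "0 < s" by auto
          define u where "u = (s1 / s) *\<^sub>R u1 + (s2 / s) *\<^sub>R u2"
          define t where "t = (s1 / s) * t1 + (s2 / s) * t2"
          have "s1 / s + s2 / s = 1" using s by (simp add: s_def flip: add_divide_distrib)
          with convexD[OF H f1(2) f2(2), of "s1 / s" "s2 / s"] have "(u, t) \<in> H"
            using f1 f2 s by (simp add: u_def t_def)
          then have "(\<lambda>v. e * norm (v + s *\<^sub>R u) - s * t) \<in> Q"
            using s by (auto simp: Q_def intro!: rev_image_eqI[where x = "(s, u, t)"])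
          moreover have "s *\<^sub>R u = s1 *\<^sub>R u1 + s2 *\<^sub>R u2" "s * t = s1 * t1 + s2 * t2"
            using s by (simp_all add: u_def t_def scaleR_add_right distrib_left)
          moreover have "e * norm (v + w + (s1 *\<^sub>R u1 + s2 *\<^sub>R u2))
              \<le> e * norm (v + s1 *\<^sub>R u1) + e * norm (w + s2 *\<^sub>R u2)"
            using tri[of "v + s1 *\<^sub>R u1" "w + s2 *\<^sub>R u2"] by (simp add: algebra_simps)
          ultimately show ?thesis
            using f1 f2 by (intro bexI[of _ "\<lambda>v. e * norm (v + s *\<^sub>R u) - s * t"]) auto
        qed
      qed
    qed
  qed
  then obtain y where y: "linear y" "\<And>v. y v \<le> q v"
    using sublinear_dominates_linear by blast
  have q_le: "q v \<le> f v" if "f \<in> Q" for f v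
    unfolding q_def using that lb by (intro cINF_lower bdd_belowI2) auto
  have y_le: "y v \<le> e * norm v" for v
    using y(2)[of v] q_le[of "\<lambda>v. e * norm v" v] by (simp add: Q_def)
  show ?thesis
  proof (rule that[OF y(1)])
    show "\<bar>y v\<bar> \<le> e * norm v" for v
      using y_le[of v] y_le[of "- v"] linear_neg[OF y(1), of v] by (simp add: abs_le_iff)
    fix u t assume ut: "(u, t) \<in> H"
    have "(\<lambda>v. e * norm (v + 1 *\<^sub>R u) - 1 * t) \<in> Q"
      using ut by (auto simp: Q_def intro!: rev_image_eqI[where x = "(1, u, t)"])
    from q_le[OF this, of "- u"] have "q (- u) \<le> - t"
      by simp
    with y(2)[of "- u"] linear_neg[OF y(1), of u] show "t \<le> y u"
      by simp
  qed
qed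

section \<open>Dyadic cells of the unit interval\<close>

text \<open>The half-open interval makes the dyadic intervals \<open>{k / 2 ^ n..<(k + 1) / 2 ^ n}\<close> partition the
  space exactly.\<close>

definition unit_lebesgue :: "real measure" where
  "unit_lebesgue = restrict_space lborel {0..<1}"

definition cell_index :: "nat \<Rightarrow> real \<Rightarrow> nat" where
  "cell_index n x = nat \<lfloor>2 ^ n * x\<rfloor>"

text \<open>The union of the dyadic intervals of length \<open>1 / 2 ^ n\<close> whose indices lie in \<open>S\<close>.\<close>

definition cells :: "nat \<Rightarrow> nat set \<Rightarrow> real set" where
  "cells n S = {x \<in> {0..<1}. cell_index n x \<in> S}"

lemma space_unit_lebesgue [simp]: "space unit_lebesgue = {0..<1}"
  by (simp add: unit_lebesgue_def space_restrict_space)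

lemma sets_unit_lebesgue: "E \<in> sets unit_lebesgue \<longleftrightarrow> E \<in> sets borel \<and> E \<subseteq> {0..<1}"
  by (simp add: unit_lebesgue_def sets_restrict_space_iff conj_commute)

lemma measure_unit_lebesgue: "E \<in> sets borel \<Longrightarrow> E \<subseteq> {0..<1} \<Longrightarrow> measure unit_lebesgue E = measure lborel E"
  by (simp add: unit_lebesgue_def measure_restrict_space)

interpretation unit: finite_measure unit_lebesgue
proof
  show "emeasure unit_lebesgue (space unit_lebesgue) \<noteq> \<infinity>"
    unfolding space_unit_lebesgue by (simp add: unit_lebesgue_def emeasure_restrict_space)
qed

lemma cell_index_less: "x \<in> {0..<1} \<Longrightarrow> cell_index n x < 2 ^ n"
proof -
  assume x: "x \<in> {0..<1}"
  then have "\<lfloor>2 ^ n * x\<rfloor> < 2 ^ n"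
    by (simp add: floor_less_iff)
  then show ?thesis
    using x by (simp add: cell_index_def nat_less_iff)
qed

lemma cell_index_div: "0 \<le> x \<Longrightarrow> cell_index (n + d) x div 2 ^ d = cell_index n x"
proof -
  assume x: "0 \<le> x"
  have "\<lfloor>2 ^ n * x\<rfloor> = \<lfloor>2 ^ (n + d) * x / real_of_int (2 ^ d)\<rfloor>"
    by (simp add: power_add)
  also have "\<dots> = \<lfloor>2 ^ (n + d) * x\<rfloor> div 2 ^ d"
    by (rule floor_divide_real_eq_div) simp
  finally show ?thesis
    using x by (simp add: cell_index_def nat_div_distrib nat_power_eq)
qed

lemma cells_refine: "cells n S = cells (n + d) {k. k div 2 ^ d \<in> S}"
  by (auto simp: cells_def cell_index_div)

lemma cell_index_measurable [measurable]: "cell_index n \<in> measurable unit_lebesgue (count_space UNIV)"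
  unfolding unit_lebesgue_def cell_index_def by (intro measurable_restrict_space1) measurable

lemma cells_sets [measurable, simp]: "cells n S \<in> sets unit_lebesgue"
proof -
  have "cells n S = cell_index n -` S \<inter> space unit_lebesgue"
    by (auto simp: cells_def)
  then show ?thesis
    using measurable_sets[OF cell_index_measurable, of S n] by simp
qed

lemma cell_eq_interval:
  assumes "k < 2 ^ n"
  shows "cells n {k} = {real k / 2 ^ n..<real (Suc k) / 2 ^ n}"
proof -
  have k: "real (Suc k) \<le> 2 ^ n"
    using assms by (metis Suc_leI of_nat_le_iff of_nat_numeral of_nat_power)
  have "x \<in> cells n {k} \<longleftrightarrow> real k / 2 ^ n \<le> x \<and> x < real (Suc k) / 2 ^ n" for x
  proof -
    have "x < 1" if "x < real (Suc k) / 2 ^ n"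
      using that k by (meson divide_le_eq_1_pos order_less_le_trans zero_less_numeral zero_less_power)
    moreover have "0 \<le> x" if "real k / 2 ^ n \<le> x"
      using that by (meson divide_nonneg_nonneg of_nat_0_le_iff order_trans zero_le_numeral zero_le_power)
    moreover have "cell_index n x = k \<longleftrightarrow> real k / 2 ^ n \<le> x \<and> x < real (Suc k) / 2 ^ n" if "0 \<le> x"
    proof -
      have "cell_index n x = k \<longleftrightarrow> \<lfloor>2 ^ n * x\<rfloor> = int k"
        using that by (auto simp: cell_index_def)
      also have "\<dots> \<longleftrightarrow> real k \<le> 2 ^ n * x \<and> 2 ^ n * x < real (Suc k)"
        by (simp add: floor_eq_iff add.commute)
      finally show ?thesis by (simp add: field_simps)
    qed
    ultimately show ?thesis by (auto simp: cells_def)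
  qed
  then show ?thesis
    by (intro set_eqI) (simp only: atLeastLessThan_iff)
qed

lemma measure_cell: "k < 2 ^ n \<Longrightarrow> measure unit_lebesgue (cells n {k}) = 1 / 2 ^ n"
  using cells_sets[of n "{k}"]
  by (simp add: measure_unit_lebesgue sets_unit_lebesgue)
     (simp add: cell_eq_interval divide_right_mono flip: diff_divide_distrib)

lemma measure_split_cells:
  assumes "E \<in> sets unit_lebesgue"
  shows "measure unit_lebesgue E = (\<Sum>k<2 ^ n. measure unit_lebesgue (E \<inter> cells n {k}))"
proof -
  have "E = (\<Union>k<2 ^ n. E \<inter> cells n {k})"
    using assms cell_index_less by (auto simp: cells_def sets_unit_lebesgue)
  moreover have "measure unit_lebesgue (\<Union>k<2 ^ n. E \<inter> cells n {k}) = (\<Sum>k<2 ^ n. measure unit_lebesgue (E \<inter> cells n {k}))"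
    using assms by (intro unit.finite_measure_finite_Union)
      (auto simp: disjoint_family_on_def intro!: sets.Int, auto simp: cells_def)
  ultimately show ?thesis by simp
qed

lemma measure_le_add:
  assumes "A \<subseteq> B \<union> C" "B \<in> sets unit_lebesgue" "C \<in> sets unit_lebesgue"
  shows "measure unit_lebesgue A \<le> measure unit_lebesgue B + measure unit_lebesgue C"
  using unit.finite_measure_mono[OF assms(1)] measure_Un_le[OF assms(2,3)] assms
  by (meson order_trans sets.Un)

text \<open>Sets that can be approximated form a sigma-algebra: complements and finite unions of unions of cells are again
  unions of cells, and a countable union is approximated by a finite one. It contains each half-line, because
  the cell around its endpoint has small measure.\<close>

lemma borel_approx_by_cells:
  assumes "B \<in> sets borel" "0 < \<eta>"
  shows "\<exists>n S. measure unit_lebesgue (sym_diff (B \<inter> {0..<1}) (cells n S)) < \<eta>"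
proof -
  let ?\<mu> = "measure unit_lebesgue"
  have "B \<in> sigma_sets UNIV (range lessThan)"
    using assms(1) by (simp add: borel_Iio)
  then have "\<forall>\<eta>>0. \<exists>n S. ?\<mu> (sym_diff (B \<inter> {0..<1}) (cells n S)) < \<eta>"
  proof (induction rule: sigma_sets.induct)
    case (Basic B)
    then obtain a where B: "B = {..<a}" by blast
    show ?case
    proof (intro allI impI)
      fix \<eta> :: real assume "0 < \<eta>"
      then obtain n where n: "1 / 2 ^ n < \<eta>"
        using real_arch_pow_inv[of \<eta> "1/2"] by (auto simp: power_one_over)
      define b where "b = cell_index n a"
      have sub: "sym_diff (B \<inter> {0..<1}) (cells n {k. k < b}) \<subseteq> cells n {b}"
      proof
        fix x assume x: "x \<in> sym_diff (B \<inter> {0..<1}) (cells n {k. k < b})"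
        then have x01: "x \<in> {0..<1}" by (auto simp: cells_def)
        have "cell_index n x = b"
        proof (cases "x < a")
          case True
          then have "cell_index n x \<le> b"
            unfolding b_def cell_index_def by (intro nat_mono floor_mono) simp
          with True x x01 show ?thesis by (auto simp: B cells_def)
        next
          case False
          then have "b \<le> cell_index n x"
            unfolding b_def cell_index_def by (intro nat_mono floor_mono) simp
          with False x show ?thesis by (auto simp: B cells_def)
        qed
        with x01 show "x \<in> cells n {b}" by (simp add: cells_def)
      qed
      have "?\<mu> (cells n {b}) \<le> 1 / 2 ^ n"
      proof (cases "b < 2 ^ n")
        case False
        then have "cells n {b} = {}"
          using cell_index_less by (fastforce simp: cells_def)
        then show ?thesis by simp
      qed (simp add: measure_cell)
      then have "?\<mu> (sym_diff (B \<inter> {0..<1}) (cells n {k. k < b})) < \<eta>"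
        using unit.finite_measure_mono[OF sub] n by simp
      then show "\<exists>n S. ?\<mu> (sym_diff (B \<inter> {0..<1}) (cells n S)) < \<eta>"
        by blast
    qed
  next
    case Empty
    have "cells 0 {} = {}" by (simp add: cells_def)
    then show ?case by (intro allI impI exI[of _ 0] exI[of _ "{}"]) simp
  next
    case (Compl B)
    have "sym_diff ((UNIV - B) \<inter> {0..<1}) (cells n (- S)) = sym_diff (B \<inter> {0..<1}) (cells n S)" for n S
      by (auto simp: cells_def)
    with Compl.IH show ?case by (metis (no_types, lifting))
  next
    case (Union B)
    have meas: "B i \<inter> {0..<1} \<in> sets unit_lebesgue" for i
    proof -
      have "B i \<in> sets borel"
        using Union.hyps[of i] by (simp add: borel_Iio)
      then show ?thesis by (simp add: sets_unit_lebesgue)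
    qed
    have meas_UN: "(\<Union>i<N. B i) \<inter> {0..<1} \<in> sets unit_lebesgue" for N :: nat
    proof -
      have "(\<Union>i<N. B i) \<inter> {0..<1} = (\<Union>i<N. B i \<inter> {0..<1})" by blast
      then show ?thesis
        using sets.finite_UN[of "{..<N}" "\<lambda>i. B i \<inter> {0..<1}" unit_lebesgue] meas by (simp only: finite_lessThan)
    qed
    have fin: "\<forall>\<eta>>0. \<exists>n S. ?\<mu> (sym_diff ((\<Union>i<N. B i) \<inter> {0..<1}) (cells n S)) < \<eta>" for N :: nat
    proof (induction N)
      case 0
      have "cells 0 {} = {}" by (simp add: cells_def)
      then show ?case by (intro allI impI exI[of _ 0] exI[of _ "{}"]) simp
    next
      case (Suc N)
      show ?case
      proof (intro allI impI)
        fix \<eta> :: real assume "0 < \<eta>"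
        then have "0 < \<eta> / 2" by simp
        from Suc.IH[rule_format, OF this] Union.IH[rule_format, OF this, of N] obtain n S n' S' where
          nS: "?\<mu> (sym_diff ((\<Union>i<N. B i) \<inter> {0..<1}) (cells n S)) < \<eta> / 2"
              "?\<mu> (sym_diff (B N \<inter> {0..<1}) (cells n' S')) < \<eta> / 2"
          by blast
        define U where "U = {k. k div 2 ^ n' \<in> S} \<union> {k. k div 2 ^ n \<in> S'}"
        have "cells (n + n') U = cells n S \<union> cells n' S'"
          using cells_refine[of n S n'] cells_refine[of n' S' n]
          by (auto simp: U_def cells_def add.commute)
        then have "sym_diff ((\<Union>i<Suc N. B i) \<inter> {0..<1}) (cells (n + n') U)
            \<subseteq> sym_diff ((\<Union>i<N. B i) \<inter> {0..<1}) (cells n S) \<union> sym_diff (B N \<inter> {0..<1}) (cells n' S')"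
          by (auto simp: less_Suc_eq)
        then have "?\<mu> (sym_diff ((\<Union>i<Suc N. B i) \<inter> {0..<1}) (cells (n + n') U)) < \<eta>"
          using nS meas[of N] meas_UN[of N] measure_le_add[of "sym_diff ((\<Union>i<Suc N. B i) \<inter> {0..<1}) (cells (n + n') U)"
            "sym_diff ((\<Union>i<N. B i) \<inter> {0..<1}) (cells n S)" "sym_diff (B N \<inter> {0..<1}) (cells n' S')"]
          by simp
        then show "\<exists>n S. ?\<mu> (sym_diff ((\<Union>i<Suc N. B i) \<inter> {0..<1}) (cells n S)) < \<eta>"
          by blast
      qed
    qed
    show ?case
    proof (intro allI impI)
      fix \<eta> :: real assume "0 < \<eta>"
      define W where "W N = (\<Union>i<N. B i) \<inter> {0..<1}" for N :: nat
      have W: "W N \<in> sets unit_lebesgue" for N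
        unfolding W_def by (rule meas_UN)
      have "(\<lambda>N. ?\<mu> (W N)) \<longlonglongrightarrow> ?\<mu> (\<Union>N. W N)"
        using W by (intro unit.finite_Lim_measure_incseq) (auto simp: incseq_def W_def intro: less_le_trans)
      moreover have UW: "(\<Union>N. W N) = (\<Union>i. B i) \<inter> {0..<1}"
        by (auto simp: W_def)
      ultimately have lim: "(\<lambda>N. ?\<mu> (W N)) \<longlonglongrightarrow> ?\<mu> ((\<Union>i. B i) \<inter> {0..<1})"
        by simp
      have "?\<mu> ((\<Union>i. B i) \<inter> {0..<1}) - \<eta> / 2 < ?\<mu> ((\<Union>i. B i) \<inter> {0..<1})"
        using \<open>0 < \<eta>\<close> by simp
      from order_tendstoD(1)[OF lim this]
      obtain N where N: "?\<mu> ((\<Union>i. B i) \<inter> {0..<1}) - \<eta> / 2 < ?\<mu> (W N)"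
        by (auto simp: eventually_sequentially)
      have UWs: "(\<Union>i. B i) \<inter> {0..<1} \<in> sets unit_lebesgue"
        unfolding UW[symmetric] using W by blast
      have "W N \<subseteq> (\<Union>i. B i) \<inter> {0..<1}" by (auto simp: W_def)
      with N W UWs have tail: "?\<mu> ((\<Union>i. B i) \<inter> {0..<1} - W N) < \<eta> / 2"
        by (simp add: unit.finite_measure_Diff)
      from fin[of N] \<open>0 < \<eta>\<close> obtain n S where nS: "?\<mu> (sym_diff (W N) (cells n S)) < \<eta> / 2"
        unfolding W_def using half_gt_zero by blast
      have "sym_diff ((\<Union>i. B i) \<inter> {0..<1}) (cells n S)
          \<subseteq> ((\<Union>i. B i) \<inter> {0..<1} - W N) \<union> sym_diff (W N) (cells n S)"
        by (auto simp: W_def)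
      then have "?\<mu> (sym_diff ((\<Union>i. B i) \<inter> {0..<1}) (cells n S))
          \<le> ?\<mu> ((\<Union>i. B i) \<inter> {0..<1} - W N) + ?\<mu> (sym_diff (W N) (cells n S))"
        using W UWs by (intro measure_le_add) auto
      with tail nS have "?\<mu> (sym_diff ((\<Union>i. B i) \<inter> {0..<1}) (cells n S)) < \<eta>"
        by linarith
      then show "\<exists>n S. ?\<mu> (sym_diff ((\<Union>i. B i) \<inter> {0..<1}) (cells n S)) < \<eta>"
        by blast
    qed
  qed
  with assms(2) show ?thesis by blast
qed

lemma approx_by_cells:
  assumes "E \<in> sets unit_lebesgue" "0 < \<eta>"
  obtains n S where "measure unit_lebesgue (sym_diff E (cells n S)) < \<eta>"
proof -
  have "E \<in> sets borel" "E \<inter> {0..<1} = E"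
    using assms(1) by (auto simp: sets_unit_lebesgue)
  with borel_approx_by_cells[of E \<eta>] assms(2) that show ?thesis by auto
qed

section \<open>Integrals of step functions\<close>

text \<open>The integral over \<open>E\<close> of the step function with value \<open>h k\<close> on the
  \<open>k\<close>-th cell of level \<open>p\<close>.\<close>

definition step_integral :: "nat \<Rightarrow> (nat \<Rightarrow> 'a::real_normed_vector) \<Rightarrow> real set \<Rightarrow> 'a" where
  "step_integral p h E = (\<Sum>k<2 ^ p. measure unit_lebesgue (E \<inter> cells p {k}) *\<^sub>R h k)"

text \<open>The mean of \<open>h\<close> over the \<open>2 ^ d\<close> cells into which the \<open>k\<close>-th cell
  splits \<open>d\<close> levels further down.\<close>

definition block_average :: "nat \<Rightarrow> (nat \<Rightarrow> 'a::real_vector) \<Rightarrow> nat \<Rightarrow> 'a" where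
  "block_average d h k = (1 / 2 ^ d) *\<^sub>R (\<Sum>j<2 ^ d. h (k * 2 ^ d + j))"

lemma sum_blocks:
  fixes h :: "nat \<Rightarrow> 'a::comm_monoid_add"
  shows "(\<Sum>k<2 ^ p. \<Sum>j<2 ^ d. h (k * 2 ^ d + j)) = (\<Sum>k<2 ^ (p + d). h k)"
proof -
  have "(\<Sum>j<2 ^ d. h (k * 2 ^ d + j)) = sum h {k * 2 ^ d..<k * 2 ^ d + 2 ^ d}" for k
    using sum.shift_bounds_nat_ivl[of h 0 "k * 2 ^ d" "2 ^ d"] by (simp add: atLeast0LessThan add.commute)
  then show ?thesis
    by (simp add: sum.nat_group power_add)
qed

lemma block_index_less: "k < 2 ^ p \<Longrightarrow> j < 2 ^ d \<Longrightarrow> k * 2 ^ d + j < (2::nat) ^ (p + d)"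
proof -
  assume "k < 2 ^ p" "j < 2 ^ d"
  then have "k * 2 ^ d + j < Suc k * 2 ^ d" "Suc k * 2 ^ d \<le> 2 ^ p * 2 ^ d"
    by (simp, intro mult_le_mono1 Suc_leI)
  then show ?thesis by (simp only: power_add)
qed

lemma cells_empty [simp]: "cells p {} = {}"
  by (simp add: cells_def)

lemma cells_Int: "cells p S \<inter> cells p S' = cells p (S \<inter> S')"
  by (auto simp: cells_def)

lemma step_integral_empty [simp]: "step_integral p h {} = 0"
  by (simp add: step_integral_def)

lemma norm_step_integral_diff_le:
  assumes h: "\<And>k. k < 2 ^ p \<Longrightarrow> norm (h k) \<le> K" and E: "E \<in> sets unit_lebesgue" "E' \<in> sets unit_lebesgue"
  shows "norm (step_integral p h E - step_integral p h E') \<le> K * measure unit_lebesgue (sym_diff E E')"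
proof -
  let ?\<mu> = "measure unit_lebesgue"
  have m: "\<bar>?\<mu> (E \<inter> A) - ?\<mu> (E' \<inter> A)\<bar> \<le> ?\<mu> (sym_diff E E' \<inter> A)" if "A \<in> sets unit_lebesgue" for A
  proof -
    have "?\<mu> (B \<inter> A) \<le> ?\<mu> (B' \<inter> A) + ?\<mu> (sym_diff B B' \<inter> A)" if "B \<in> sets unit_lebesgue" "B' \<in> sets unit_lebesgue" for B B'
      using that \<open>A \<in> sets unit_lebesgue\<close> by (intro measure_le_add) auto
    from this[OF E] this[OF E(2,1)] show ?thesis
      by (simp add: abs_le_iff Un_commute)
  qed
  have "norm (step_integral p h E - step_integral p h E')
      = norm (\<Sum>k<2 ^ p. (?\<mu> (E \<inter> cells p {k}) - ?\<mu> (E' \<inter> cells p {k})) *\<^sub>R h k)"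
    by (simp add: step_integral_def scaleR_diff_left sum_subtractf)
  also have "\<dots> \<le> (\<Sum>k<2 ^ p. ?\<mu> (sym_diff E E' \<inter> cells p {k}) * K)"
  proof (rule order_trans[OF norm_sum], rule sum_mono)
    fix k :: nat assume "k \<in> {..<2 ^ p}"
    then show "norm ((?\<mu> (E \<inter> cells p {k}) - ?\<mu> (E' \<inter> cells p {k})) *\<^sub>R h k)
        \<le> ?\<mu> (sym_diff E E' \<inter> cells p {k}) * K"
      using m[of "cells p {k}"] h[of k] by (auto intro!: mult_mono)
  qed
  also have "\<dots> = K * ?\<mu> (sym_diff E E')"
    using E measure_split_cells[of "sym_diff E E'" p] by (simp add: sum_distrib_left mult.commute)
  finally show ?thesis .
qed

lemma norm_step_integral_le:
  assumes "\<And>k. k < 2 ^ p \<Longrightarrow> norm (h k) \<le> K" "E \<in> sets unit_lebesgue"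
  shows "norm (step_integral p h E) \<le> K * measure unit_lebesgue E"
  using norm_step_integral_diff_le[of p h K E "{}"] assms by simp

lemma step_integral_Un:
  assumes "E \<in> sets unit_lebesgue" "E' \<in> sets unit_lebesgue" "E \<inter> E' = {}"
  shows "step_integral p h (E \<union> E') = step_integral p h E + step_integral p h E'"
proof -
  have "measure unit_lebesgue ((E \<union> E') \<inter> cells p {k})
      = measure unit_lebesgue (E \<inter> cells p {k}) + measure unit_lebesgue (E' \<inter> cells p {k})" for k
    unfolding Int_Un_distrib2 using assms by (intro unit.finite_measure_Union) auto
  then show ?thesis
    by (simp add: step_integral_def scaleR_add_left sum.distrib)
qed

lemma step_integral_split:
  assumes "E \<in> sets unit_lebesgue"
  shows "step_integral p h E = (\<Sum>k<2 ^ q. step_integral p h (E \<inter> cells q {k}))"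
proof -
  have "measure unit_lebesgue (E \<inter> cells p {i}) = (\<Sum>k<2 ^ q. measure unit_lebesgue (E \<inter> cells q {k} \<inter> cells p {i}))" for i
    using measure_split_cells[of "E \<inter> cells p {i}" q] assms by (simp add: Int_ac)
  then show ?thesis
    unfolding step_integral_def by (subst sum.swap) (simp add: scaleR_sum_left)
qed

lemma step_integral_cells:
  "step_integral p h (cells q S) = (\<Sum>k<2 ^ q. if k \<in> S then step_integral p h (cells q {k}) else 0)"
  by (subst step_integral_split[OF cells_sets, of _ _ _ _ q]) (auto simp: cells_Int intro!: sum.cong)

lemma step_integral_refine_cell:
  assumes "k < 2 ^ q"
  shows "step_integral p h (cells q {k}) = (\<Sum>j<2 ^ d. step_integral p h (cells (q + d) {k * 2 ^ d + j}))"
proof -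
  have "step_integral p h (cells q {k})
      = (\<Sum>i<2 ^ (q + d). if i div 2 ^ d = k then step_integral p h (cells (q + d) {i}) else 0)"
    by (subst cells_refine[of _ _ d], subst step_integral_cells) simp
  also have "\<dots> = (\<Sum>i<2 ^ q. \<Sum>j<2 ^ d. if i = k then step_integral p h (cells (q + d) {i * 2 ^ d + j}) else 0)"
    by (subst sum_blocks[symmetric]) (intro sum.cong refl, simp)
  also have "\<dots> = (\<Sum>i<2 ^ q. if i = k then (\<Sum>j<2 ^ d. step_integral p h (cells (q + d) {i * 2 ^ d + j})) else 0)"
    by (intro sum.cong refl) simp
  finally show ?thesis
    using assms by simp
qed

lemma step_integral_cell:
  assumes "k < 2 ^ q"
  shows "step_integral (q + d) h (cells q {k}) = (1 / 2 ^ q) *\<^sub>R block_average d h k"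
proof -
  have own: "step_integral p h (cells p {i}) = (1 / 2 ^ p) *\<^sub>R h i" if "i < 2 ^ p" for p i
  proof -
    have "step_integral p h (cells p {i}) = (\<Sum>k<2 ^ p. if k = i then (1 / 2 ^ p) *\<^sub>R h i else 0)"
      unfolding step_integral_def by (intro sum.cong refl) (auto simp: cells_Int measure_cell that)
    then show ?thesis using that by simp
  qed
  have "step_integral (q + d) h (cells (q + d) {k * 2 ^ d + j}) = (1 / 2 ^ (q + d)) *\<^sub>R h (k * 2 ^ d + j)"
    if "j < 2 ^ d" for j
    using that by (intro own block_index_less assms)
  then show ?thesis
    unfolding step_integral_refine_cell[OF assms, of _ _ d] block_average_def
    by (simp add: scaleR_sum_right power_add)
qed

section \<open>Dyadic quasi-martingales and their vector measures\<close>

text \<open>\<open>X n\<close> gives the values, on the cells of level \<open>m n\<close>, of a step function with values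
  in a Banach space. The conditional expectation of \<open>X (Suc n)\<close> at level \<open>m n\<close> is
  within \<open>err n\<close> of \<open>X n\<close> in mean; for a martingale this distance is zero.\<close>

locale cell_quasi_martingale =
  fixes m :: "nat \<Rightarrow> nat" and X :: "nat \<Rightarrow> nat \<Rightarrow> 'a::banach" and K :: real and err :: "nat \<Rightarrow> real"
  assumes mono_m: "strict_mono m"
    and bound: "\<And>n k. k < 2 ^ m n \<Longrightarrow> norm (X n k) \<le> K"
    and err: "\<And>n. (\<Sum>k<2 ^ m n. norm (block_average (m (Suc n) - m n) (X (Suc n)) k - X n k)) / 2 ^ m n \<le> err n"
    and summable_err: "summable err"
begin

abbreviation J :: "nat \<Rightarrow> real set \<Rightarrow> 'a" where
  "J n \<equiv> step_integral (m n) (X n)"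

definition tail :: "nat \<Rightarrow> real" where
  "tail n = (\<Sum>i. err (i + n))"

definition \<nu> :: "real set \<Rightarrow> 'a" where
  "\<nu> E = lim (\<lambda>n. J n E)"

lemma err_nonneg: "0 \<le> err n"
  by (rule order_trans[OF _ err]) (simp add: sum_nonneg)

lemma K_nonneg: "0 \<le> K"
  using bound[of 0 0] norm_ge_zero order_trans by (metis zero_less_numeral zero_less_power)

lemma tail_tendsto_0: "tail \<longlonglongrightarrow> 0"
  unfolding tail_def using suminf_exist_split2[OF summable_err] by simp

text \<open>The variation of the vector measure \<open>J (Suc n) - J n\<close> over a partition into cells does not
  decrease when the partition is refined; on the cells of level \<open>m n\<close> it is the mean distance of
  \<open>X n\<close> from the conditional expectation of \<open>X (Suc n)\<close>.\<close>

lemma one_step_variation: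
  assumes "q \<le> m n"
  shows "(\<Sum>k<2 ^ q. norm (J (Suc n) (cells q {k}) - J n (cells q {k}))) \<le> err n"
proof -
  define d where "d = m n - q"
  have d: "q + d = m n" using assms by (simp add: d_def)
  define e where "e = m (Suc n) - m n"
  have e: "m n + e = m (Suc n)"
    using strict_monoD[OF mono_m, of n "Suc n"] by (simp add: e_def)
  have "(\<Sum>k<2 ^ q. norm (J (Suc n) (cells q {k}) - J n (cells q {k})))
      \<le> (\<Sum>k<2 ^ q. \<Sum>j<2 ^ d. norm (J (Suc n) (cells (m n) {k * 2 ^ d + j}) - J n (cells (m n) {k * 2 ^ d + j})))"
  proof (rule sum_mono)
    fix k :: nat assume "k \<in> {..<2 ^ q}"
    then have k: "k < 2 ^ q" by simp
    show "norm (J (Suc n) (cells q {k}) - J n (cells q {k}))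
        \<le> (\<Sum>j<2 ^ d. norm (J (Suc n) (cells (m n) {k * 2 ^ d + j}) - J n (cells (m n) {k * 2 ^ d + j})))"
      unfolding step_integral_refine_cell[OF k, of _ _ d] d sum_subtractf[symmetric] by (rule norm_sum)
  qed
  also have "\<dots> = (\<Sum>k<2 ^ m n. norm (J (Suc n) (cells (m n) {k}) - J n (cells (m n) {k})))"
    using sum_blocks[of "\<lambda>k. norm (J (Suc n) (cells (m n) {k}) - J n (cells (m n) {k}))" d q] d by simp
  also have "\<dots> = (\<Sum>k<2 ^ m n. norm (block_average e (X (Suc n)) k - X n k) / 2 ^ m n)"
  proof (intro sum.cong refl)
    fix k :: nat assume "k \<in> {..<2 ^ m n}"
    then have k: "k < 2 ^ m n" by simp
    have "J n (cells (m n) {k}) = (1 / 2 ^ m n) *\<^sub>R X n k"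
      using step_integral_cell[OF k, of 0 "X n"] by (simp add: block_average_def)
    moreover have "J (Suc n) (cells (m n) {k}) = (1 / 2 ^ m n) *\<^sub>R block_average e (X (Suc n)) k"
      using step_integral_cell[OF k, of e "X (Suc n)"] by (simp add: e)
    ultimately show "norm (J (Suc n) (cells (m n) {k}) - J n (cells (m n) {k}))
        = norm (block_average e (X (Suc n)) k - X n k) / 2 ^ m n"
      by (simp flip: scaleR_diff_right)
  qed
  also have "\<dots> \<le> err n"
    using err[of n] by (simp add: e_def sum_divide_distrib)
  finally show ?thesis .
qed

lemma variation_le_tail:
  assumes "n \<le> n'"
  shows "(\<Sum>k<2 ^ m n. norm (J n' (cells (m n) {k}) - J n (cells (m n) {k}))) \<le> tail n"
proof -
  have "(\<Sum>k<2 ^ m n. norm (J (n + i) (cells (m n) {k}) - J n (cells (m n) {k}))) \<le> (\<Sum>l<i. err (l + n))" for i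
  proof (induction i)
    case (Suc i)
    have le: "m n \<le> m (n + i)"
      using mono_m by (simp add: strict_mono_less_eq)
    have tri: "norm (a - c) \<le> norm (a - b) + norm (b - c)" for a b c :: 'a
      using norm_triangle_ineq[of "a - b" "b - c"] by simp
    have "(\<Sum>k<2 ^ m n. norm (J (n + Suc i) (cells (m n) {k}) - J n (cells (m n) {k})))
        \<le> (\<Sum>k<2 ^ m n. norm (J (Suc (n + i)) (cells (m n) {k}) - J (n + i) (cells (m n) {k}))
            + norm (J (n + i) (cells (m n) {k}) - J n (cells (m n) {k})))"
      unfolding add_Suc_right by (intro sum_mono tri)
    also have "\<dots> \<le> err (n + i) + (\<Sum>l<i. err (l + n))"
      unfolding sum.distrib by (intro add_mono one_step_variation Suc.IH le)
    finally show ?case by (simp add: add.commute)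
  qed simp
  from this[of "n' - n"] assms
  have "(\<Sum>k<2 ^ m n. norm (J n' (cells (m n) {k}) - J n (cells (m n) {k}))) \<le> (\<Sum>l<n' - n. err (l + n))"
    by simp
  also have "\<dots> \<le> tail n"
    unfolding tail_def using summable_err err_nonneg by (intro sum_le_suminf) (auto simp: summable_iff_shift)
  finally show ?thesis .
qed

text \<open>On unions of cells the integrals form a Cauchy sequence since the errors are summable. A general set is
  approximated by such a union; as the step functions are uniformly bounded by \<open>K\<close>, this changes
  all integrals by little.\<close>

lemma Cauchy_J:
  assumes E: "E \<in> sets unit_lebesgue"
  shows "Cauchy (\<lambda>n. J n E)"
proof (rule CauchyI')
  fix e :: real assume e: "0 < e"
  \<comment> \<open>With this \<open>\<eta>\<close>, replacing \<open>E\<close> by a union of cells changes each integral by at most \<open>e / 4\<close>.\<close>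
  define \<eta> where "\<eta> = e / (4 * (K + 1))"
  have \<eta>: "0 < \<eta>" "K * \<eta> \<le> e / 4"
    using e K_nonneg by (auto simp: \<eta>_def field_simps)
  obtain q S where A: "measure unit_lebesgue (sym_diff E (cells q S)) < \<eta>"
    using approx_by_cells[OF E \<eta>(1)] by blast
  have close: "norm (J n E - J n (cells q S)) \<le> e / 4" for n
  proof -
    have "norm (J n E - J n (cells q S)) \<le> K * measure unit_lebesgue (sym_diff E (cells q S))"
      using bound E by (intro norm_step_integral_diff_le) auto
    also have "\<dots> \<le> K * \<eta>"
      using A K_nonneg by (intro mult_left_mono) auto
    finally show ?thesis using \<eta> by simp
  qed
  have "\<forall>\<^sub>F n in sequentially. tail n < e / 4"
    using tail_tendsto_0 e by (intro order_tendstoD) auto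
  then obtain N0 where N0: "\<And>n. N0 \<le> n \<Longrightarrow> tail n < e / 4"
    by (auto simp: eventually_sequentially)
  define N where "N = max q N0"
  have "norm (J n' E - J n E) < e" if n: "N \<le> n" "n \<le> n'" for n n'
  proof -
    have "q \<le> m n"
      using n seq_suble[OF mono_m, of n] by (simp add: N_def)
    then obtain d where d: "m n = q + d" using le_Suc_ex by blast
    define S' where "S' = {k. k div 2 ^ d \<in> S}"
    have AS: "cells q S = cells (m n) S'"
      unfolding d S'_def by (rule cells_refine)
    have "norm (J n' (cells q S) - J n (cells q S))
        = norm (\<Sum>k<2 ^ m n. if k \<in> S' then J n' (cells (m n) {k}) - J n (cells (m n) {k}) else 0)"
      unfolding AS step_integral_cells[of _ _ "m n" S'] sum_subtractf[symmetric]
      by (intro arg_cong[where f = norm] sum.cong) auto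
    also have "\<dots> \<le> (\<Sum>k<2 ^ m n. norm (J n' (cells (m n) {k}) - J n (cells (m n) {k})))"
      by (rule sum_norm_le) auto
    also have "\<dots> \<le> tail n"
      using n by (intro variation_le_tail) auto
    also have "\<dots> < e / 4"
      using n N0 by (simp add: N_def)
    finally have "norm (J n' (cells q S) - J n (cells q S)) < e / 4" .
    moreover have "norm (a - b) \<le> norm (a - a') + norm (a' - b') + norm (b - b')" for a b a' b' :: 'a
      using norm_triangle_ineq4[of "(a - a') + (a' - b')" "b - b'"] norm_triangle_ineq[of "a - a'" "a' - b'"]
      by simp
    ultimately have "norm (J n' E - J n E) < e / 4 + e / 4 + e / 4"
      using close[of n] close[of n'] by (meson add_less_le_mono add_le_less_mono le_less_trans)
    with e show ?thesis by simp
  qed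
  then show "\<exists>M. \<forall>m\<ge>M. \<forall>n>m. dist (J m E) (J n E) < e"
    by (intro exI[of _ N]) (auto simp: dist_norm norm_minus_commute)
qed

lemma J_tendsto: "E \<in> sets unit_lebesgue \<Longrightarrow> (\<lambda>n. J n E) \<longlonglongrightarrow> \<nu> E"
  unfolding \<nu>_def using Cauchy_J Cauchy_convergent convergent_LIMSEQ_iff by blast

lemma norm_\<nu>_le:
  assumes "E \<in> sets unit_lebesgue"
  shows "norm (\<nu> E) \<le> K * measure unit_lebesgue E"
proof (rule tendsto_upperbound[OF tendsto_norm[OF J_tendsto[OF assms]]])
  show "\<forall>\<^sub>F n in sequentially. norm (J n E) \<le> K * measure unit_lebesgue E"
    using bound assms by (intro always_eventually allI norm_step_integral_le)
qed simp

lemma \<nu>_Un: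
  assumes "E \<in> sets unit_lebesgue" "E' \<in> sets unit_lebesgue" "E \<inter> E' = {}"
  shows "\<nu> (E \<union> E') = \<nu> E + \<nu> E'"
proof (rule LIMSEQ_unique)
  show "(\<lambda>n. J n (E \<union> E')) \<longlonglongrightarrow> \<nu> (E \<union> E')"
    using assms by (intro J_tendsto) auto
  show "(\<lambda>n. J n (E \<union> E')) \<longlonglongrightarrow> \<nu> E + \<nu> E'"
    unfolding step_integral_Un[OF assms] using assms by (intro tendsto_add J_tendsto)
qed

lemma \<nu>_approximates:
  "(\<Sum>k<2 ^ m n. norm (\<nu> (cells (m n) {k}) - J n (cells (m n) {k}))) \<le> tail n"
proof (rule tendsto_upperbound)
  show "(\<lambda>n'. \<Sum>k<2 ^ m n. norm (J n' (cells (m n) {k}) - J n (cells (m n) {k})))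
      \<longlonglongrightarrow> (\<Sum>k<2 ^ m n. norm (\<nu> (cells (m n) {k}) - J n (cells (m n) {k})))"
    by (intro tendsto_intros J_tendsto) auto
  show "\<forall>\<^sub>F n' in sequentially. (\<Sum>k<2 ^ m n. norm (J n' (cells (m n) {k}) - J n (cells (m n) {k}))) \<le> tail n"
    using variation_le_tail by (auto simp: eventually_sequentially)
qed simp

text \<open>Finite additivity passes to the limit, and the bound \<open>norm (\<nu> E) \<le> K * measure unit_lebesgue
  E\<close> upgrades it to countable additivity.\<close>

lemma vector_measure_\<nu>: "vector_measure unit_lebesgue \<nu>"
  unfolding vector_measure_def
proof (intro allI impI)
  fix A :: "nat \<Rightarrow> real set"
  assume A: "range A \<subseteq> sets unit_lebesgue" "disjoint_family A"
  have A': "A i \<in> sets unit_lebesgue" for i using A by blast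
  have fin: "(\<Sum>i<n. \<nu> (A i)) = \<nu> (\<Union>i<n. A i)" for n
  proof (induction n)
    case 0
    show ?case using norm_\<nu>_le[of "{}"] by simp
  next
    case (Suc n)
    have "A i \<inter> A n = {}" if "i < n" for i
      using that disjoint_family_onD[OF A(2), of i n] by auto
    then have "(\<Union>i<n. A i) \<inter> A n = {}" by blast
    then have "\<nu> ((\<Union>i<n. A i) \<union> A n) = \<nu> (\<Union>i<n. A i) + \<nu> (A n)"
      using A' by (intro \<nu>_Un) auto
    then show ?case
      using Suc by (simp add: lessThan_Suc Un_commute)
  qed
  have "(\<lambda>n. \<nu> (\<Union>i. A i) - (\<Sum>i<n. \<nu> (A i))) \<longlonglongrightarrow> 0"
  proof (rule Lim_null_comparison)
    let ?R = "\<lambda>n. (\<Union>i. A i) - (\<Union>i<n. A i)"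
    show "\<forall>\<^sub>F n in sequentially. norm (\<nu> (\<Union>i. A i) - (\<Sum>i<n. \<nu> (A i))) \<le> K * measure unit_lebesgue (?R n)"
    proof (intro always_eventually allI)
      fix n
      have "\<nu> ((\<Union>i<n. A i) \<union> ?R n) = \<nu> (\<Union>i<n. A i) + \<nu> (?R n)"
        using A' by (intro \<nu>_Un) auto
      moreover have "(\<Union>i<n. A i) \<union> ?R n = (\<Union>i. A i)" by blast
      ultimately have "\<nu> (\<Union>i. A i) - (\<Sum>i<n. \<nu> (A i)) = \<nu> (?R n)"
        by (simp add: fin)
      then show "norm (\<nu> (\<Union>i. A i) - (\<Sum>i<n. \<nu> (A i))) \<le> K * measure unit_lebesgue (?R n)"
        using A' by (auto intro!: norm_\<nu>_le)
    qed
    have "(\<lambda>n. measure unit_lebesgue (?R n)) \<longlonglongrightarrow> measure unit_lebesgue (\<Inter>n. ?R n)"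
      using A' by (intro unit.finite_Lim_measure_decseq) (auto simp: decseq_def)
    moreover have "(\<Inter>n. ?R n) = {}" by blast
    ultimately have "(\<lambda>n. measure unit_lebesgue (?R n)) \<longlonglongrightarrow> 0"
      by (simp only: measure_empty)
    then show "(\<lambda>n. K * measure unit_lebesgue (?R n)) \<longlonglongrightarrow> 0"
      by (rule tendsto_mult_right_zero)
  qed
  then have "(\<lambda>n. \<nu> (\<Union>i. A i) - (\<nu> (\<Union>i. A i) - (\<Sum>i<n. \<nu> (A i)))) \<longlonglongrightarrow> \<nu> (\<Union>i. A i) - 0"
    by (intro tendsto_intros)
  then show "(\<lambda>i. \<nu> (A i)) sums \<nu> (\<Union>i. A i)"
    by (simp add: sums_def)
qed

lemma of_bounded_variation_\<nu>: "of_bounded_variation unit_lebesgue \<nu>"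
  unfolding of_bounded_variation_def
proof (intro exI allI impI)
  fix P assume P: "finite P" "P \<subseteq> sets unit_lebesgue" "partition_on (space unit_lebesgue) P"
  have "(\<Sum>E\<in>P. norm (\<nu> E)) \<le> (\<Sum>E\<in>P. K * measure unit_lebesgue E)"
    using P by (intro sum_mono norm_\<nu>_le) auto
  also have "\<dots> = K * measure unit_lebesgue (\<Union>P)"
    using P unit.finite_measure_finite_Union[of P "\<lambda>E. E"]
    by (simp add: sum_distrib_left partition_on_def disjoint_def disjoint_family_on_def)
  also have "\<Union>P = space unit_lebesgue"
    using P(3) by (simp add: partition_on_def)
  finally show "(\<Sum>E\<in>P. norm (\<nu> E)) \<le> K * measure unit_lebesgue (space unit_lebesgue)" .
qed

lemma abs_continuous_\<nu>: "abs_continuous unit_lebesgue \<nu>"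
  unfolding abs_continuous_def
proof
  fix E assume "E \<in> null_sets unit_lebesgue"
  then have "E \<in> sets unit_lebesgue" "measure unit_lebesgue E = 0"
    by (auto simp: null_sets_def measure_def)
  with norm_\<nu>_le[of E] show "\<nu> E = 0" by simp
qed

end

section \<open>Densities and convergence in mean\<close>

lemma simple_bochner_integral_indicator:
  assumes "A \<in> sets M" "emeasure M A \<noteq> \<infinity>"
  shows "Bochner_Integration.simple_bochner_integral M (\<lambda>x. indicator A x *\<^sub>R c) = measure M A *\<^sub>R c"
    and "Bochner_Integration.simple_bochner_integrable M (\<lambda>x. indicator A x *\<^sub>R c)"
proof -
  have int: "Bochner_Integration.simple_bochner_integrable M (indicator A :: _ \<Rightarrow> real)"
  proof
    have "{y \<in> space M. indicator A y \<noteq> (0::real)} = A"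
      using sets.sets_into_space[OF assms(1)] by (auto simp: indicator_def)
    with assms show "emeasure M {y \<in> space M. indicator A y \<noteq> (0::real)} \<noteq> \<infinity>" by simp
  qed (use assms in simp)
  have "ennreal (Bochner_Integration.simple_bochner_integral M (indicator A)) = (\<integral>\<^sup>+x. ennreal (indicator A x) \<partial>M)"
    by (rule simple_bochner_integral_eq_nn_integral[OF int]) simp
  also have "\<dots> = ennreal (measure M A)"
    using assms by (simp add: ennreal_indicator emeasure_eq_ennreal_measure)
  finally have "Bochner_Integration.simple_bochner_integral M (indicator A :: _ \<Rightarrow> real) = measure M A"
    by (subst (asm) ennreal_inj) auto
  moreover have lin: "linear (\<lambda>r::real. r *\<^sub>R c)"
    by (simp add: linear_iff scaleR_add_left)
  ultimately show "Bochner_Integration.simple_bochner_integral M (\<lambda>x. indicator A x *\<^sub>R c) = measure M A *\<^sub>R c"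
    using simple_bochner_integral_linear[OF lin int] by simp
  show "Bochner_Integration.simple_bochner_integrable M (\<lambda>x. indicator A x *\<^sub>R c)"
    using simple_bochner_integrable_compose2[OF _ int int, of "\<lambda>r _. r *\<^sub>R c"] by simp
qed

text \<open>Without second countability the difference of two measurable functions need not be measurable. As
  \<open>s\<close> takes finitely many values, only the continuous functions \<open>y \<mapsto> norm (y -
  v)\<close> are needed.\<close>

lemma borel_measurable_norm_diff_simple:
  fixes f :: "'m \<Rightarrow> 'a::real_normed_vector"
  assumes f: "f \<in> borel_measurable M" and s: "simple_function M s"
  shows "(\<lambda>x. norm (f x - s x)) \<in> borel_measurable M"
proof -
  have fin: "finite (s ` space M)"
    using s by (simp add: simple_function_def)
  have "(\<lambda>x. \<Sum>v\<in>s ` space M. indicator (s -` {v} \<inter> space M) x * norm (f x - v)) \<in> borel_measurable M"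
  proof (intro borel_measurable_sum borel_measurable_times borel_measurable_indicator)
    fix v assume "v \<in> s ` space M"
    with s show "s -` {v} \<inter> space M \<in> sets M"
      unfolding simple_function_def by blast
    have "(\<lambda>y. norm (y - v)) \<in> borel_measurable borel"
      by (intro borel_measurable_continuous_onI continuous_intros)
    then show "(\<lambda>x. norm (f x - v)) \<in> borel_measurable M"
      using measurable_compose[OF f] by blast
  qed
  moreover have "(\<Sum>v\<in>s ` space M. indicator (s -` {v} \<inter> space M) x * norm (f x - v)) = norm (f x - s x)"
    if x: "x \<in> space M" for x
  proof -
    have "(\<Sum>v\<in>s ` space M. indicator (s -` {v} \<inter> space M) x * norm (f x - v))
        = (\<Sum>v\<in>s ` space M. if v = s x then norm (f x - v) else 0)"
      using x by (intro sum.cong) auto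
    then show ?thesis using x fin by simp
  qed
  ultimately show ?thesis
    by (subst (asm) measurable_cong) auto
qed

text \<open>The triangle inequality for the integral of \<open>f - t\<close>, inherited from the simple functions that
  define the integral of \<open>f\<close>.\<close>

lemma has_vector_integral_diff_simple_le:
  fixes f :: "'m \<Rightarrow> 'a::real_normed_vector"
  assumes f: "has_vector_integral M f I" and t: "Bochner_Integration.simple_bochner_integrable M t"
  shows "ennreal (norm (I - Bochner_Integration.simple_bochner_integral M t)) \<le> (\<integral>\<^sup>+x. norm (f x - t x) \<partial>M)"
proof -
  obtain s where fm: "f \<in> borel_measurable M" and s: "\<And>i. Bochner_Integration.simple_bochner_integrable M (s i)"
    and lim0: "(\<lambda>i::nat. \<integral>\<^sup>+x. ennreal (norm (f x - s i x)) \<partial>M) \<longlonglongrightarrow> 0"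
    and lim: "(\<lambda>i. Bochner_Integration.simple_bochner_integral M (s i)) \<longlonglongrightarrow> I"
    using f unfolding has_vector_integral_def by blast
  have sf: "simple_function M u" if "Bochner_Integration.simple_bochner_integrable M u" for u :: "'m \<Rightarrow> 'a"
    using that by (auto elim: simple_bochner_integrable.cases)
  have meas: "(\<lambda>x. ennreal (norm (f x - u x))) \<in> borel_measurable M" if "Bochner_Integration.simple_bochner_integrable M u" for u
    using borel_measurable_norm_diff_simple[OF fm sf[OF that]] by simp
  have le: "ennreal (norm (Bochner_Integration.simple_bochner_integral M (s i) - Bochner_Integration.simple_bochner_integral M t))
      \<le> (\<integral>\<^sup>+x. norm (f x - s i x) \<partial>M) + (\<integral>\<^sup>+x. norm (f x - t x) \<partial>M)" for i
  proof -
    have "ennreal (norm (Bochner_Integration.simple_bochner_integral M (s i) - Bochner_Integration.simple_bochner_integral M t))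
        = norm (Bochner_Integration.simple_bochner_integral M (\<lambda>x. s i x - t x))"
      using s t by (subst simple_bochner_integral_diff) auto
    also have "\<dots> \<le> Bochner_Integration.simple_bochner_integral M (\<lambda>x. norm (s i x - t x))"
      using simple_bochner_integrable_compose2[of "(-)", OF _ s t]
      by (auto intro!: simple_bochner_integral_norm_bound)
    also have "\<dots> = (\<integral>\<^sup>+x. norm (s i x - t x) \<partial>M)"
      using simple_bochner_integrable_compose2[of "\<lambda>x y. norm (x - y)", OF _ s t]
      by (auto intro!: simple_bochner_integral_eq_nn_integral)
    also have "\<dots> \<le> (\<integral>\<^sup>+x. ennreal (norm (f x - s i x)) + ennreal (norm (f x - t x)) \<partial>M)"
    proof (rule nn_integral_mono)
      fix x
      have "norm (s i x - t x) \<le> norm (f x - s i x) + norm (f x - t x)"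
        using norm_triangle_ineq4[of "f x - t x" "f x - s i x"] by simp
      then show "ennreal (norm (s i x - t x)) \<le> ennreal (norm (f x - s i x)) + ennreal (norm (f x - t x))"
        by (simp flip: ennreal_plus)
    qed
    also have "\<dots> = (\<integral>\<^sup>+x. norm (f x - s i x) \<partial>M) + (\<integral>\<^sup>+x. norm (f x - t x) \<partial>M)"
      using meas s t by (intro nn_integral_add) auto
    finally show ?thesis .
  qed
  have limL: "(\<lambda>i. ennreal (norm (Bochner_Integration.simple_bochner_integral M (s i) - Bochner_Integration.simple_bochner_integral M t)))
      \<longlonglongrightarrow> ennreal (norm (I - Bochner_Integration.simple_bochner_integral M t))"
    by (intro tendsto_ennrealI tendsto_intros lim)
  have limR: "(\<lambda>i. (\<integral>\<^sup>+x. norm (f x - s i x) \<partial>M) + (\<integral>\<^sup>+x. norm (f x - t x) \<partial>M))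
      \<longlonglongrightarrow> 0 + (\<integral>\<^sup>+x. norm (f x - t x) \<partial>M)"
    by (intro tendsto_add lim0 tendsto_const)
  show ?thesis
    using LIMSEQ_le[OF limL limR] le by simp
qed


lemma simple_function_cell_index: "simple_function unit_lebesgue (cell_index q)"
  unfolding simple_function_def
proof
  have "cell_index q ` space unit_lebesgue \<subseteq> {..<2 ^ q}"
    using cell_index_less by auto
  then show "finite (cell_index q ` space unit_lebesgue)"
    using finite_subset by blast
  show "\<forall>k\<in>cell_index q ` space unit_lebesgue. cell_index q -` {k} \<inter> space unit_lebesgue \<in> sets unit_lebesgue"
    using measurable_sets[OF cell_index_measurable] by simp
qed

text \<open>By definition \<open>f\<close> is a limit in mean of simple functions, and each of the finitely many level
  sets of such a function is nearly a union of cells.\<close>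

lemma L1_approx_by_cell_step_function:
  fixes f :: "real \<Rightarrow> 'a::real_normed_vector"
  assumes f: "has_vector_integral unit_lebesgue f I" and \<eta>: "0 < \<eta>"
  obtains q g where "(\<integral>\<^sup>+x. norm (f x - g (cell_index q x)) \<partial>unit_lebesgue) < ennreal \<eta>"
proof -
  let ?M = unit_lebesgue
  let ?\<mu> = "measure ?M"
  obtain s where fm: "f \<in> borel_measurable ?M" and s: "\<And>i. Bochner_Integration.simple_bochner_integrable ?M (s i)"
    and lim0: "(\<lambda>i::nat. \<integral>\<^sup>+x. ennreal (norm (f x - s i x)) \<partial>?M) \<longlonglongrightarrow> 0"
    using f unfolding has_vector_integral_def by blast
  have "\<forall>\<^sub>F i in sequentially. (\<integral>\<^sup>+x. ennreal (norm (f x - s i x)) \<partial>?M) < ennreal (\<eta> / 2)"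
    using lim0 \<eta> by (intro order_tendstoD) auto
  then obtain i where i: "(\<integral>\<^sup>+x. ennreal (norm (f x - s i x)) \<partial>?M) < ennreal (\<eta> / 2)"
    by (auto simp: eventually_sequentially)
  define V where "V = s i ` space ?M"
  define E where "E v = s i -` {v} \<inter> space ?M" for v
  have sf: "simple_function ?M (s i)"
    using s by (auto elim: simple_bochner_integrable.cases)
  then have V: "finite V" and E: "\<And>v. v \<in> V \<Longrightarrow> E v \<in> sets ?M"
    by (auto simp: simple_function_def V_def E_def)
  \<comment> \<open>The summand 1 keeps \<open>c\<close> positive when \<open>s i\<close> vanishes.\<close>
  define c where "c = (\<Sum>v\<in>V. norm v) + 1"
  have c: "0 < c" by (simp add: c_def sum_nonneg add_nonneg_pos)
  have "\<exists>n S. ?\<mu> (sym_diff (E v) (cells n S)) < \<eta> / (2 * c)" if "v \<in> V" for v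
    using approx_by_cells[OF E[OF that]] \<eta> c by (metis divide_pos_pos mult_pos_pos zero_less_numeral)
  then obtain n S where nS: "\<And>v. v \<in> V \<Longrightarrow> ?\<mu> (sym_diff (E v) (cells (n v) (S v))) < \<eta> / (2 * c)"
    by metis
  \<comment> \<open>A common level, so that one step function represents all the approximating unions of cells.\<close>
  define q where "q = Max (insert 0 (n ` V))"
  have n_le: "n v \<le> q" if "v \<in> V" for v
    unfolding q_def using V that by (intro Max_ge) auto
  define g where "g k = (\<Sum>v\<in>V. indicator {k. k div 2 ^ (q - n v) \<in> S v} k *\<^sub>R v)" for k :: nat
  define D where "D v = sym_diff (E v) (cells (n v) (S v))" for v
  have D: "D v \<in> sets ?M" if "v \<in> V" for v
    using E[OF that] by (auto simp: D_def)
  have pointwise: "norm (s i x - g (cell_index q x)) \<le> (\<Sum>v\<in>V. indicator (D v) x * norm v)" if x: "x \<in> space ?M" for x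
  proof -
    have g: "g (cell_index q x) = (\<Sum>v\<in>V. indicator (cells (n v) (S v)) x *\<^sub>R v)"
      unfolding g_def
    proof (intro sum.cong refl)
      fix v assume "v \<in> V"
      then have "cell_index q x div 2 ^ (q - n v) = cell_index (n v) x"
        using cell_index_div[of x "n v" "q - n v"] n_le x by simp
      with x show "indicator {k. k div 2 ^ (q - n v) \<in> S v} (cell_index q x) *\<^sub>R v
          = indicator (cells (n v) (S v)) x *\<^sub>R v"
        by (simp add: indicator_def cells_def)
    qed
    have "s i x = (\<Sum>v\<in>V. if v = s i x then v else 0)"
      using x V by (simp add: V_def)
    also have "\<dots> = (\<Sum>v\<in>V. indicator (E v) x *\<^sub>R v)"
      using x by (intro sum.cong) (auto simp: E_def)
    finally have "s i x - g (cell_index q x)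
        = (\<Sum>v\<in>V. (indicator (E v) x - indicator (cells (n v) (S v)) x) *\<^sub>R v)"
      by (simp add: g scaleR_diff_left sum_subtractf)
    also have "norm \<dots> \<le> (\<Sum>v\<in>V. indicator (D v) x * norm v)"
      by (rule sum_norm_le) (auto simp: D_def indicator_def)
    finally show ?thesis .
  qed
  have "(\<integral>\<^sup>+x. norm (f x - g (cell_index q x)) \<partial>?M)
      \<le> (\<integral>\<^sup>+x. ennreal (norm (f x - s i x)) + ennreal (\<Sum>v\<in>V. indicator (D v) x * norm v) \<partial>?M)"
  proof (rule nn_integral_mono)
    fix x assume x: "x \<in> space ?M"
    have "norm (f x - g (cell_index q x)) \<le> norm (f x - s i x) + (\<Sum>v\<in>V. indicator (D v) x * norm v)"
      using norm_triangle_ineq[of "f x - s i x" "s i x - g (cell_index q x)"] pointwise[OF x] by simp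
    then show "ennreal (norm (f x - g (cell_index q x)))
        \<le> ennreal (norm (f x - s i x)) + ennreal (\<Sum>v\<in>V. indicator (D v) x * norm v)"
      by (simp add: sum_nonneg flip: ennreal_plus)
  qed
  also have "\<dots> = (\<integral>\<^sup>+x. ennreal (norm (f x - s i x)) \<partial>?M) + (\<integral>\<^sup>+x. ennreal (\<Sum>v\<in>V. indicator (D v) x * norm v) \<partial>?M)"
  proof (rule nn_integral_add)
    show "(\<lambda>x. ennreal (norm (f x - s i x))) \<in> borel_measurable ?M"
      using measurable_compose[OF borel_measurable_norm_diff_simple[OF fm sf] measurable_ennreal] by simp
    have "(\<lambda>x. \<Sum>v\<in>V. indicator (D v) x * norm v) \<in> borel_measurable ?M"
      by (intro borel_measurable_sum borel_measurable_times borel_measurable_indicator D) auto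
    then show "(\<lambda>x. ennreal (\<Sum>v\<in>V. indicator (D v) x * norm v)) \<in> borel_measurable ?M"
      using measurable_compose[OF _ measurable_ennreal] by blast
  qed
  also have "(\<integral>\<^sup>+x. ennreal (\<Sum>v\<in>V. indicator (D v) x * norm v) \<partial>?M) = ennreal (\<Sum>v\<in>V. ?\<mu> (D v) * norm v)"
  proof -
    have "(\<integral>\<^sup>+x. ennreal (\<Sum>v\<in>V. indicator (D v) x * norm v) \<partial>?M)
        = (\<integral>\<^sup>+x. (\<Sum>v\<in>V. ennreal (norm v) * indicator (D v) x) \<partial>?M)"
    proof (rule nn_integral_cong)
      fix x
      have "ennreal (\<Sum>v\<in>V. indicator (D v) x * norm v) = (\<Sum>v\<in>V. ennreal (indicator (D v) x * norm v))"
        by (rule sum_ennreal[symmetric]) simp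
      also have "\<dots> = (\<Sum>v\<in>V. ennreal (norm v) * indicator (D v) x)"
        by (intro sum.cong refl) (simp add: indicator_def)
      finally show "ennreal (\<Sum>v\<in>V. indicator (D v) x * norm v) = (\<Sum>v\<in>V. ennreal (norm v) * indicator (D v) x)" .
    qed
    also have "\<dots> = (\<Sum>v\<in>V. ennreal (norm v) * emeasure ?M (D v))"
      using D by (subst nn_integral_sum) (auto simp: nn_integral_cmult_indicator)
    also have "\<dots> = ennreal (\<Sum>v\<in>V. ?\<mu> (D v) * norm v)"
    proof -
      have "(\<Sum>v\<in>V. ennreal (norm v) * emeasure ?M (D v)) = (\<Sum>v\<in>V. ennreal (?\<mu> (D v) * norm v))"
        by (intro sum.cong refl) (simp add: unit.emeasure_eq_measure ennreal_mult' mult.commute)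
      also have "\<dots> = ennreal (\<Sum>v\<in>V. ?\<mu> (D v) * norm v)"
        by (rule sum_ennreal) simp
      finally show ?thesis .
    qed
    finally show ?thesis .
  qed
  finally have le: "(\<integral>\<^sup>+x. norm (f x - g (cell_index q x)) \<partial>?M)
      \<le> (\<integral>\<^sup>+x. ennreal (norm (f x - s i x)) \<partial>?M) + ennreal (\<Sum>v\<in>V. ?\<mu> (D v) * norm v)" .
  have sum_le: "(\<Sum>v\<in>V. ?\<mu> (D v) * norm v) \<le> \<eta> / 2"
  proof -
    have "(\<Sum>v\<in>V. ?\<mu> (D v) * norm v) \<le> (\<Sum>v\<in>V. \<eta> / (2 * c) * norm v)"
      using nS by (intro sum_mono mult_right_mono) (auto simp: D_def intro: less_imp_le)
    also have "\<dots> = \<eta> / (2 * c) * (c - 1)"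
      by (simp add: c_def sum_distrib_left)
    also have "\<dots> \<le> \<eta> / 2"
      using c \<eta> by (simp add: field_simps)
    finally show ?thesis .
  qed
  have "(\<integral>\<^sup>+x. norm (f x - g (cell_index q x)) \<partial>?M)
      \<le> (\<integral>\<^sup>+x. ennreal (norm (f x - s i x)) \<partial>?M) + ennreal (\<eta> / 2)"
    using le by (rule order_trans) (intro add_left_mono ennreal_leI sum_le)
  also have "\<dots> < ennreal (\<eta> / 2) + ennreal (\<eta> / 2)"
    using i by (subst (1 2) add.commute, subst ennreal_add_left_cancel_less) auto
  also have "\<dots> = ennreal \<eta>"
    using \<eta> by (simp flip: ennreal_plus)
  finally show ?thesis by (rule that)
qed

context cell_quasi_martingale
begin

text \<open>Let \<open>f\<close> be the density of \<open>\<nu>\<close>, and let \<open>g\<close> be a step function on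
  the cells of level \<open>q\<close> near \<open>f\<close> in mean. At every level \<open>m n \<ge> q\<close>,
  the conditional expectation of \<open>f\<close> is near \<open>g\<close>, as \<open>g\<close> is its own
  conditional expectation, and it differs from \<open>X n\<close> in mean by at most \<open>tail n\<close>. So
  \<open>X n\<close> and \<open>X (Suc n)\<close> are both near \<open>g\<close> for large \<open>n\<close>.\<close>

theorem RNP_increments_small:
  assumes RNP: "radon_nikodym_property TYPE('a)" and \<eta>: "0 < \<eta>"
  shows "\<exists>n. (\<Sum>k<2 ^ m (Suc n). norm (X (Suc n) k - X n (k div 2 ^ (m (Suc n) - m n)))) / 2 ^ m (Suc n) < \<eta>"
proof -
  let ?M = unit_lebesgue
  obtain f where f: "\<And>E. E \<in> sets ?M \<Longrightarrow> has_vector_integral ?M (\<lambda>x. indicator E x *\<^sub>R f x) (\<nu> E)"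
    using RNP vector_measure_\<nu> of_bounded_variation_\<nu> abs_continuous_\<nu> unit.finite_measure_axioms
    unfolding radon_nikodym_property_def radon_nikodym_for_def by metis
  define f0 where "f0 x = indicator (space ?M) x *\<^sub>R f x" for x
  have f0: "has_vector_integral ?M f0 (\<nu> (space ?M))"
    unfolding f0_def by (rule f) (rule sets.top)
  from \<eta> have "0 < \<eta> / 4" by simp
  with f0 obtain q g where qg: "(\<integral>\<^sup>+x. norm (f0 x - g (cell_index q x)) \<partial>?M) < ennreal (\<eta> / 4)"
    by (rule L1_approx_by_cell_step_function)
  have dev_meas: "(\<lambda>x. norm (f0 x - g (cell_index q x))) \<in> borel_measurable ?M"
    using f0 simple_function_compose1[OF simple_function_cell_index[of q], of g]
    by (intro borel_measurable_norm_diff_simple) (auto simp: has_vector_integral_def)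
  have \<nu>_near_g: "(\<Sum>k<2 ^ (q + d). norm (\<nu> (cells (q + d) {k}) - (1 / 2 ^ (q + d)) *\<^sub>R g (k div 2 ^ d))) \<le> \<eta> / 4" for d
  proof -
    have "ennreal (norm (\<nu> (cells (q + d) {k}) - (1 / 2 ^ (q + d)) *\<^sub>R g (k div 2 ^ d)))
        \<le> (\<integral>\<^sup>+x. indicator (cells (q + d) {k}) x * ennreal (norm (f0 x - g (cell_index q x))) \<partial>?M)"
      if k: "k < 2 ^ (q + d)" for k
    proof -
      let ?c = "cells (q + d) {k}"
      have c: "?c \<in> sets ?M" "emeasure ?M ?c \<noteq> \<infinity>" by auto
      have "ennreal (norm (\<nu> ?c - measure ?M ?c *\<^sub>R g (k div 2 ^ d)))
          \<le> (\<integral>\<^sup>+x. norm (indicator ?c x *\<^sub>R f x - indicator ?c x *\<^sub>R g (k div 2 ^ d)) \<partial>?M)"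
        using has_vector_integral_diff_simple_le[OF f[OF c(1)] simple_bochner_integral_indicator(2)[OF c, of "g (k div 2 ^ d)"]]
        unfolding simple_bochner_integral_indicator(1)[OF c] .
      also have "\<dots> = (\<integral>\<^sup>+x. indicator ?c x * ennreal (norm (f0 x - g (cell_index q x))) \<partial>?M)"
      proof (rule nn_integral_cong)
        fix x assume x: "x \<in> space ?M"
        then have "k div 2 ^ d = cell_index q x" if "x \<in> ?c"
          using that cell_index_div[of x q d] by (auto simp: cells_def)
        with x show "ennreal (norm (indicator ?c x *\<^sub>R f x - indicator ?c x *\<^sub>R g (k div 2 ^ d)))
            = indicator ?c x * ennreal (norm (f0 x - g (cell_index q x)))"
          by (simp add: f0_def indicator_def)
      qed
      finally show ?thesis by (simp add: measure_cell[OF k])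
    qed
    then have "(\<Sum>k<2 ^ (q + d). ennreal (norm (\<nu> (cells (q + d) {k}) - (1 / 2 ^ (q + d)) *\<^sub>R g (k div 2 ^ d))))
        \<le> (\<Sum>k<2 ^ (q + d). \<integral>\<^sup>+x. indicator (cells (q + d) {k}) x * ennreal (norm (f0 x - g (cell_index q x))) \<partial>?M)"
      by (intro sum_mono) simp
    also have "\<dots> = (\<integral>\<^sup>+x. (\<Sum>k<2 ^ (q + d). indicator (cells (q + d) {k}) x * ennreal (norm (f0 x - g (cell_index q x)))) \<partial>?M)"
    proof (rule nn_integral_sum[symmetric])
      fix k
      show "(\<lambda>x. indicator (cells (q + d) {k}) x * ennreal (norm (f0 x - g (cell_index q x)))) \<in> borel_measurable ?M"
        using measurable_compose[OF dev_meas measurable_ennreal]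
        by (intro borel_measurable_times_ennreal borel_measurable_indicator) auto
    qed
    also have "\<dots> = (\<integral>\<^sup>+x. ennreal (norm (f0 x - g (cell_index q x))) \<partial>?M)"
    proof (rule nn_integral_cong)
      fix x assume x: "x \<in> space ?M"
      let ?t = "ennreal (norm (f0 x - g (cell_index q x)))"
      have "(\<Sum>k<2 ^ (q + d). indicator (cells (q + d) {k}) x * ?t) = (\<Sum>k<2 ^ (q + d). if k = cell_index (q + d) x then ?t else 0)"
        using x by (intro sum.cong) (auto simp: cells_def)
      also have "\<dots> = ?t"
        using cell_index_less x by simp
      finally show "(\<Sum>k<2 ^ (q + d). indicator (cells (q + d) {k}) x * ?t) = ?t" .
    qed
    also have "\<dots> \<le> ennreal (\<eta> / 4)"
      using qg by simp
    finally have "ennreal (\<Sum>k<2 ^ (q + d). norm (\<nu> (cells (q + d) {k}) - (1 / 2 ^ (q + d)) *\<^sub>R g (k div 2 ^ d))) \<le> ennreal (\<eta> / 4)"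
      by (simp add: sum_ennreal)
    then show ?thesis
      using \<eta> by (simp add: ennreal_le_iff)
  qed
  define A where "A n = (\<Sum>k<2 ^ m n. norm (X n k - g (k div 2 ^ (m n - q)))) / 2 ^ m n" for n
  have A_le: "A n \<le> \<eta> / 4 + tail n" if "q \<le> m n" for n
  proof -
    define d where "d = m n - q"
    have d: "q + d = m n" using that by (simp add: d_def)
    have "A n = (\<Sum>k<2 ^ m n. norm ((1 / 2 ^ m n) *\<^sub>R X n k - (1 / 2 ^ m n) *\<^sub>R g (k div 2 ^ d)))"
      by (simp add: A_def d_def sum_divide_distrib flip: scaleR_diff_right)
    also have "\<dots> \<le> (\<Sum>k<2 ^ m n. norm (\<nu> (cells (m n) {k}) - (1 / 2 ^ m n) *\<^sub>R g (k div 2 ^ d))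
        + norm (\<nu> (cells (m n) {k}) - J n (cells (m n) {k})))"
    proof (rule sum_mono)
      fix k :: nat assume "k \<in> {..<2 ^ m n}"
      then have "J n (cells (m n) {k}) = (1 / 2 ^ m n) *\<^sub>R X n k"
        using step_integral_cell[of k "m n" 0 "X n"] by (simp add: block_average_def)
      then show "norm ((1 / 2 ^ m n) *\<^sub>R X n k - (1 / 2 ^ m n) *\<^sub>R g (k div 2 ^ d))
          \<le> norm (\<nu> (cells (m n) {k}) - (1 / 2 ^ m n) *\<^sub>R g (k div 2 ^ d))
            + norm (\<nu> (cells (m n) {k}) - J n (cells (m n) {k}))"
        using norm_triangle_ineq4[of "\<nu> (cells (m n) {k}) - (1 / 2 ^ m n) *\<^sub>R g (k div 2 ^ d)"
            "\<nu> (cells (m n) {k}) - J n (cells (m n) {k})"] by simp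
    qed
    also have "\<dots> \<le> \<eta> / 4 + tail n"
      unfolding sum.distrib using \<nu>_near_g[of d] \<nu>_approximates[of n] unfolding d by (rule add_mono)
    finally show ?thesis .
  qed
  have "\<forall>\<^sub>F n in sequentially. tail n < \<eta> / 4"
    using tail_tendsto_0 \<open>0 < \<eta> / 4\<close> by (rule order_tendstoD)
  then obtain N where N: "\<And>n. N \<le> n \<Longrightarrow> tail n < \<eta> / 4"
    by (auto simp: eventually_sequentially)
  define n where "n = max N q"
  have q: "q \<le> m n" "q \<le> m (Suc n)"
    using seq_suble[OF mono_m, of n] seq_suble[OF mono_m, of "Suc n"] by (auto simp: n_def)
  define e where "e = m (Suc n) - m n"
  have e: "m n + e = m (Suc n)"
    using strict_monoD[OF mono_m, of n "Suc n"] by (simp add: e_def)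
  have div: "k div 2 ^ e div 2 ^ (m n - q) = k div 2 ^ (m (Suc n) - q)" for k :: nat
  proof -
    have "e + (m n - q) = m (Suc n) - q" using e q by simp
    then show ?thesis by (simp only: div_mult2_eq[symmetric] power_add[symmetric])
  qed
  have "(\<Sum>k<2 ^ m (Suc n). norm (X (Suc n) k - X n (k div 2 ^ e)))
      \<le> (\<Sum>k<2 ^ m (Suc n). norm (X (Suc n) k - g (k div 2 ^ (m (Suc n) - q)))
          + norm (X n (k div 2 ^ e) - g (k div 2 ^ e div 2 ^ (m n - q))))"
  proof (rule sum_mono)
    fix k
    show "norm (X (Suc n) k - X n (k div 2 ^ e)) \<le> norm (X (Suc n) k - g (k div 2 ^ (m (Suc n) - q)))
          + norm (X n (k div 2 ^ e) - g (k div 2 ^ e div 2 ^ (m n - q)))"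
      unfolding div
      using norm_triangle_ineq4[of "X (Suc n) k - g (k div 2 ^ (m (Suc n) - q))" "X n (k div 2 ^ e) - g (k div 2 ^ (m (Suc n) - q))"]
      by simp
  qed
  also have "\<dots> = 2 ^ m (Suc n) * (A (Suc n) + A n)"
  proof -
    have "(\<Sum>k<2 ^ m (Suc n). norm (X n (k div 2 ^ e) - g (k div 2 ^ e div 2 ^ (m n - q))))
        = 2 ^ e * (\<Sum>k<2 ^ m n. norm (X n k - g (k div 2 ^ (m n - q))))"
      unfolding e[symmetric] sum_blocks[symmetric] by (simp add: sum_distrib_left)
    moreover have "(2::real) ^ m (Suc n) = 2 ^ e * 2 ^ m n"
      unfolding e[symmetric] by (simp add: power_add)
    ultimately show ?thesis
      by (simp add: A_def sum.distrib field_simps)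
  qed
  finally have "(\<Sum>k<2 ^ m (Suc n). norm (X (Suc n) k - X n (k div 2 ^ e))) / 2 ^ m (Suc n) \<le> A (Suc n) + A n"
    by (simp add: field_simps)
  also have "\<dots> < \<eta>"
  proof -
    have "tail n < \<eta> / 4" "tail (Suc n) < \<eta> / 4"
      by (intro N; simp add: n_def)+
    with A_le[OF q(1)] A_le[OF q(2)] show ?thesis by linarith
  qed
  finally show ?thesis
    unfolding e_def by blast
qed

end

section \<open>Bushes and small slices\<close>

text \<open>Convex combinations with weights \<open>1 / 2 ^ d\<close>, points of \<open>A\<close> being allowed to repeat.
  They can replace the convex hull up to closure, and they can be realised by splitting a cell into equal parts.\<close>

definition dyadic_averages :: "'v::real_vector set \<Rightarrow> nat \<Rightarrow> 'v set" where
  "dyadic_averages A d = {block_average d y 0 |y. \<forall>j<2 ^ d. y j \<in> A}"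

lemma dyadic_averages_mono:
  assumes "d \<le> d'"
  shows "dyadic_averages A d \<subseteq> dyadic_averages A d'"
proof
  fix p assume "p \<in> dyadic_averages A d"
  then obtain y where y: "\<And>j. j < 2 ^ d \<Longrightarrow> y j \<in> A" "p = block_average d y 0"
    by (auto simp: dyadic_averages_def)
  obtain e where e: "d' = d + e" using assms le_Suc_ex by blast
  define y' where "y' j = y (j div 2 ^ e)" for j
  have "(\<Sum>j<2 ^ d'. y' j) = 2 ^ e *\<^sub>R (\<Sum>j<2 ^ d. y j)"
    unfolding e sum_blocks[symmetric] by (simp add: y'_def sum_constant_scaleR scaleR_sum_right)
  then have "p = block_average d' y' 0"
    by (simp add: y block_average_def e power_add)
  moreover have "y' j \<in> A" if "j < 2 ^ d'" for j
    unfolding y'_def using that by (intro y(1)) (simp add: e power_add less_mult_imp_div_less)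
  ultimately show "p \<in> dyadic_averages A d'"
    by (auto simp: dyadic_averages_def)
qed

lemma midpoint_in_dyadic_averages:
  assumes "p \<in> dyadic_averages A d" "q \<in> dyadic_averages A d"
  shows "midpoint p q \<in> dyadic_averages A (Suc d)"
proof -
  obtain y z where y: "\<And>j. j < 2 ^ d \<Longrightarrow> y j \<in> A" "p = block_average d y 0"
    and z: "\<And>j. j < 2 ^ d \<Longrightarrow> z j \<in> A" "q = block_average d z 0"
    using assms by (auto simp: dyadic_averages_def)
  define w where "w j = (if j < 2 ^ d then y j else z (j - 2 ^ d))" for j
  have "(\<Sum>j<2 ^ Suc d. w j) = (\<Sum>i<2 ^ 1. \<Sum>j<2 ^ d. w (i * 2 ^ d + j))"
    using sum_blocks[of w d 1] by simp
  also have "\<dots> = (\<Sum>j<2 ^ d. y j) + (\<Sum>j<2 ^ d. z j)"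
    by (simp add: w_def numeral_2_eq_2)
  finally have "midpoint p q = block_average (Suc d) w 0"
    by (simp add: y z midpoint_def block_average_def scaleR_add_right)
  moreover have "w j \<in> A" if "j < 2 ^ Suc d" for j
    using that y(1)[of j] z(1)[of "j - 2 ^ d"] by (auto simp: w_def)
  ultimately show ?thesis
    by (auto simp: dyadic_averages_def)
qed

text \<open>If a point of the segment from \<open>p\<close> to \<open>q\<close> were missing, the midpoint of the gap
  around it would be missing too, although the endpoints of the gap belong to the closed set \<open>S\<close>.\<close>

lemma closed_midpoint_convex_imp_convex:
  fixes S :: "'v::real_normed_vector set"
  assumes "closed S" and mid: "\<And>p q. p \<in> S \<Longrightarrow> q \<in> S \<Longrightarrow> midpoint p q \<in> S"
  shows "convex S"
proof -
  have "(1 - t) *\<^sub>R p + t *\<^sub>R q \<in> S" if pq: "p \<in> S" "q \<in> S" and t: "0 \<le> t" "t \<le> 1" for p q t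
  proof (rule ccontr)
    assume not: "(1 - t) *\<^sub>R p + t *\<^sub>R q \<notin> S"
    let ?l = "\<lambda>u. (1 - u) *\<^sub>R p + u *\<^sub>R q"
    define T where "T = ?l -` S"
    have "closed T"
      unfolding T_def by (intro closed_vimage assms(1) continuous_intros)
    then have cpt: "compact (T \<inter> {0..t})" "compact (T \<inter> {t..1})"
      by (auto intro: closed_Int_compact)
    have "0 \<in> T \<inter> {0..t}" "1 \<in> T \<inter> {t..1}"
      using pq t by (auto simp: T_def)
    then obtain a b where a: "a \<in> T \<inter> {0..t}" "\<And>u. u \<in> T \<inter> {0..t} \<Longrightarrow> u \<le> a"
      and b: "b \<in> T \<inter> {t..1}" "\<And>u. u \<in> T \<inter> {t..1} \<Longrightarrow> b \<le> u"
      using compact_attains_sup[OF cpt(1)] compact_attains_inf[OF cpt(2)] by (metis empty_iff)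
    have "t \<notin> T" using not by (simp add: T_def)
    with a b have ab: "a < t" "t < b" "0 \<le> a" "b \<le> 1"
      by (auto simp: order.strict_iff_order)
    have "?l ((a + b) / 2) = midpoint (?l a) (?l b)"
      by (simp add: midpoint_def algebra_simps add_divide_distrib)
        (simp flip: scaleR_add_left)
    then have "(a + b) / 2 \<in> T"
      using a(1) b(1) mid by (simp add: T_def)
    then show False
      using a(2)[of "(a + b) / 2"] b(2)[of "(a + b) / 2"] ab by (cases "(a + b) / 2 \<le> t") auto
  qed
  then show ?thesis
    by (auto simp: convex_alt)
qed

lemma convex_closure_dyadic_averages:
  fixes A :: "'v::real_normed_vector set"
  shows "convex (closure (\<Union>d. dyadic_averages A d))"
proof (rule closed_midpoint_convex_imp_convex)
  fix p q assume "p \<in> closure (\<Union>d. dyadic_averages A d)" "q \<in> closure (\<Union>d. dyadic_averages A d)"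
  then obtain P Q where P: "\<And>n. P n \<in> (\<Union>d. dyadic_averages A d)" "P \<longlonglongrightarrow> p"
    and Q: "\<And>n. Q n \<in> (\<Union>d. dyadic_averages A d)" "Q \<longlonglongrightarrow> q"
    unfolding closure_sequential by blast
  have "midpoint (P n) (Q n) \<in> (\<Union>d. dyadic_averages A d)" for n
  proof -
    obtain d e where "P n \<in> dyadic_averages A d" "Q n \<in> dyadic_averages A e"
      using P(1)[of n] Q(1)[of n] by blast
    then have "midpoint (P n) (Q n) \<in> dyadic_averages A (Suc (max d e))"
      using dyadic_averages_mono[of d "max d e" A] dyadic_averages_mono[of e "max d e" A]
      by (intro midpoint_in_dyadic_averages) auto
    then show ?thesis by blast
  qed
  moreover have "(\<lambda>n. midpoint (P n) (Q n)) \<longlonglongrightarrow> midpoint p q"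
    unfolding midpoint_def by (intro tendsto_intros P Q)
  ultimately show "midpoint p q \<in> closure (\<Union>d. dyadic_averages A d)"
    unfolding closure_sequential by (intro exI[of _ "\<lambda>n. midpoint (P n) (Q n)"] conjI allI)
qed simp

text \<open>Otherwise the points \<open>(a - x, \<phi> a - \<phi> x + \<eta>)\<close>, for \<open>a \<in> D\<close> at
  distance at least \<open>\<delta> / 2\<close> from \<open>x\<close>, have all their dyadic averages below the
  cone \<open>t = \<epsilon> * norm u\<close>. The functional \<open>l\<close> given by the sandwich theorem
  then makes \<open>\<phi> - l\<close> at each such \<open>a\<close> smaller by at least \<open>\<eta>\<close>
  than at \<open>x\<close>, so that it has a slice within \<open>\<delta> / 2\<close> of \<open>x\<close>. The
  number \<open>2 ^ e\<close> of points averaged can be any large power of two, which lets finitely many points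
  \<open>x\<close> be treated with the same \<open>e\<close>.\<close>

lemma bush_step:
  fixes D :: "'a::real_normed_vector set" and \<phi> :: "'a \<Rightarrow> real"
  assumes pos: "0 < \<epsilon>" "0 < \<eta>" and x: "x \<in> D"
    and no_slice: "\<And>y :: 'a \<Rightarrow>\<^sub>L real. \<And>\<beta>. norm y \<le> \<epsilon> \<Longrightarrow> \<exists>u\<in>D. \<beta> < \<phi> u + blinfun_apply y u \<Longrightarrow>
      \<exists>u\<in>D. \<exists>v\<in>D. \<beta> < \<phi> u + blinfun_apply y u \<and> \<beta> < \<phi> v + blinfun_apply y v \<and> \<delta> \<le> dist u v"
  obtains d where
    "\<And>e. d \<le> e \<Longrightarrow> \<exists>y. (\<forall>j<2 ^ e. y j \<in> D \<and> \<delta> / 2 \<le> dist (y j) x) \<and>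
      \<epsilon> * norm (block_average e y 0 - x) \<le> block_average e (\<lambda>j. \<phi> (y j)) 0 - \<phi> x + \<eta>"
proof -
  define A where "A = {a \<in> D. \<delta> / 2 \<le> dist a x}"
  define H where "H = (\<lambda>a. (a - x, \<phi> a - \<phi> x + \<eta>)) ` A"
  have "\<exists>d. \<exists>(u, t) \<in> dyadic_averages H d. \<epsilon> * norm u < t"
  proof (rule ccontr)
    assume "\<not> ?thesis"
    then have le: "t \<le> \<epsilon> * norm u" if "(u, t) \<in> (\<Union>d. dyadic_averages H d)" for u t
      using that by force
    then have sub: "(\<Union>d. dyadic_averages H d) \<subseteq> {p. snd p \<le> \<epsilon> * norm (fst p)}"
      by (intro subsetI) (metis mem_Collect_eq prod.collapse)
    have le_cl: "t \<le> \<epsilon> * norm u" if ut: "(u, t) \<in> closure (\<Union>d. dyadic_averages H d)" for u t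
    proof -
      have "closure (\<Union>d. dyadic_averages H d) \<subseteq> {p. snd p \<le> \<epsilon> * norm (fst p)}"
        by (intro closure_minimal[OF sub] closed_Collect_le continuous_intros)
      with ut show ?thesis by auto
    qed
    obtain l where l: "linear l" "\<And>v. \<bar>l v\<bar> \<le> \<epsilon> * norm v"
      "\<And>u t. (u, t) \<in> closure (\<Union>d. dyadic_averages H d) \<Longrightarrow> t \<le> l u"
    proof (rule sandwich_theorem[of "closure (\<Union>d. dyadic_averages H d)" \<epsilon>])
      show "convex (closure (\<Union>d. dyadic_averages H d))"
        by (rule convex_closure_dyadic_averages)
    qed (use pos(1) le_cl in auto)
    have bl: "bounded_linear (\<lambda>v. - l v)"
      using l(1,2) by (intro bounded_linear_intro[where K = \<epsilon>])
        (auto simp: linear_add linear_scale mult.commute)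
    define y where "y = Blinfun (\<lambda>v. - l v)"
    have y: "blinfun_apply y v = - l v" for v
      by (simp add: y_def bounded_linear_Blinfun_apply[OF bl])
    have "norm y \<le> \<epsilon>"
      using l(2) pos by (intro norm_blinfun_bound) (auto simp: y)
    moreover define \<beta> where "\<beta> = \<phi> x + blinfun_apply y x - \<eta>"
    moreover have "\<beta> < \<phi> x + blinfun_apply y x"
      using pos by (simp add: \<beta>_def)
    ultimately obtain u v where uv: "u \<in> D" "v \<in> D" "\<beta> < \<phi> u + blinfun_apply y u"
      "\<beta> < \<phi> v + blinfun_apply y v" "\<delta> \<le> dist u v"
      using no_slice[of y \<beta>] x by blast
    have "a \<notin> A" if "\<beta> < \<phi> a + blinfun_apply y a" for a
    proof
      assume "a \<in> A"
      then have "(a - x, \<phi> a - \<phi> x + \<eta>) \<in> dyadic_averages H 0"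
        by (auto simp: dyadic_averages_def H_def block_average_def intro!: exI[of _ "\<lambda>_. (a - x, \<phi> a - \<phi> x + \<eta>)"])
      then have "(a - x, \<phi> a - \<phi> x + \<eta>) \<in> closure (\<Union>d. dyadic_averages H d)"
        by (intro subsetD[OF closure_subset] UN_I[of 0] UNIV_I)
      from l(3)[OF this] that show False
        by (simp add: \<beta>_def y linear_diff[OF l(1)])
    qed
    then have "dist u x < \<delta> / 2" "dist v x < \<delta> / 2"
      using uv by (auto simp: A_def not_le)
    then show False
      using uv(5) dist_triangle2[of u v x] by simp
  qed
  then obtain d u t where ut: "(u, t) \<in> dyadic_averages H d" "\<epsilon> * norm u < t"
    by blast
  show ?thesis
  proof (rule that)
    fix e assume "d \<le> e"
    then have "(u, t) \<in> dyadic_averages H e"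
      by (rule subsetD[OF dyadic_averages_mono ut(1)])
    then obtain z where z: "\<And>j. j < 2 ^ e \<Longrightarrow> z j \<in> H" "(u, t) = block_average e z 0"
      by (auto simp: dyadic_averages_def)
    have "\<forall>j\<in>{..<2 ^ e}. \<exists>a. a \<in> A \<and> z j = (a - x, \<phi> a - \<phi> x + \<eta>)"
      using z(1) unfolding H_def by blast
    from bchoice[OF this] obtain a
      where a: "\<And>j. j < 2 ^ e \<Longrightarrow> a j \<in> A" "\<And>j. j < 2 ^ e \<Longrightarrow> z j = (a j - x, \<phi> (a j) - \<phi> x + \<eta>)"
      by auto
    have "u = fst (block_average e z 0)" "t = snd (block_average e z 0)"
      using z(2) by (metis fst_conv, metis snd_conv)
    then have "u = (1 / 2 ^ e) *\<^sub>R (\<Sum>j<2 ^ e. a j - x)" "t = (1 / 2 ^ e) *\<^sub>R (\<Sum>j<2 ^ e. \<phi> (a j) - \<phi> x + \<eta>)"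
      using a(2) by (simp_all add: block_average_def fst_sum snd_sum)
    then have "u = block_average e a 0 - x" "t = block_average e (\<lambda>j. \<phi> (a j)) 0 - \<phi> x + \<eta>"
      by (simp_all add: block_average_def sum_subtractf sum.distrib sum_constant_scaleR scaleR_diff_right
          diff_divide_distrib add_divide_distrib)
    with ut(2) a(1) show "\<exists>y. (\<forall>j<2 ^ e. y j \<in> D \<and> \<delta> / 2 \<le> dist (y j) x) \<and>
      \<epsilon> * norm (block_average e y 0 - x) \<le> block_average e (\<lambda>j. \<phi> (y j)) 0 - \<phi> x + \<eta>"
      by (intro exI[of _ a]) (auto simp: A_def)
  qed
qed

text \<open>Since \<open>step\<close> allows every sufficiently large depth at each point, one depth serves for all the
  finitely many cells of level \<open>p\<close> at once.\<close>

lemma bush_level: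
  fixes D :: "'a::real_normed_vector set" and h :: "nat \<Rightarrow> 'a" and \<phi> :: "'a \<Rightarrow> real"
  assumes h: "\<And>k. k < 2 ^ p \<Longrightarrow> h k \<in> D"
    and step: "\<And>x. x \<in> D \<Longrightarrow> \<exists>d. \<forall>e\<ge>d. \<exists>y. (\<forall>j<2 ^ e. y j \<in> D \<and> \<delta> / 2 \<le> dist (y j) x) \<and>
      \<epsilon> * norm (block_average e y 0 - x) \<le> block_average e (\<lambda>j. \<phi> (y j)) 0 - \<phi> x + \<eta>"
  obtains d h' where "0 < d" "\<And>k. k < 2 ^ (p + d) \<Longrightarrow> h' k \<in> D"
    "\<And>k. k < 2 ^ (p + d) \<Longrightarrow> \<delta> / 2 \<le> dist (h' k) (h (k div 2 ^ d))"
    "\<And>k. k < 2 ^ p \<Longrightarrow> \<epsilon> * norm (block_average d h' k - h k) \<le> block_average d (\<lambda>j. \<phi> (h' j)) k - \<phi> (h k) + \<eta>"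
proof -
  define Y where "Y x e y \<longleftrightarrow> (\<forall>j<2 ^ e. y j \<in> D \<and> \<delta> / 2 \<le> dist (y j) x) \<and>
      \<epsilon> * norm (block_average e y 0 - x) \<le> block_average e (\<lambda>j. \<phi> (y j)) 0 - \<phi> x + \<eta>" for x e y
  have "\<forall>k\<in>{..<2 ^ p}. \<exists>d. \<forall>e\<ge>d. \<exists>y. Y (h k) e y"
    unfolding Y_def using step h by blast
  from bchoice[OF this] obtain d0 where d0: "\<And>k e. k < 2 ^ p \<Longrightarrow> d0 k \<le> e \<Longrightarrow> \<exists>y. Y (h k) e y"
    by auto
  \<comment> \<open>One depth for all cells; \<open>Suc\<close> makes the levels strictly increasing.\<close>
  define d where "d = Suc (Max (d0 ` {..<2 ^ p}))"
  have "d0 k \<le> d" if "k < 2 ^ p" for k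
    unfolding d_def using that by (intro le_SucI Max_ge) auto
  with d0 have "\<forall>k\<in>{..<2 ^ p}. \<exists>y. Y (h k) d y" by auto
  from bchoice[OF this] obtain y where y: "\<And>k. k < 2 ^ p \<Longrightarrow> Y (h k) d (y k)"
    by auto
  define h' where "h' i = y (i div 2 ^ d) (i mod 2 ^ d)" for i
  have avg: "block_average d (\<lambda>i. f (h' i)) k = block_average d (\<lambda>j. f (y k j)) 0" for k and f :: "'a \<Rightarrow> 'b::real_vector"
    unfolding block_average_def h'_def by (intro arg_cong2[where f = scaleR] sum.cong refl) simp
  show ?thesis
  proof (rule that[of d h'])
    fix k :: nat assume "k < 2 ^ (p + d)"
    then have "k div 2 ^ d < 2 ^ p" "k mod 2 ^ d < 2 ^ d"
      by (auto simp: power_add less_mult_imp_div_less)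
    with y[of "k div 2 ^ d"] show "h' k \<in> D" "\<delta> / 2 \<le> dist (h' k) (h (k div 2 ^ d))"
      by (auto simp: Y_def h'_def)
  next
    fix k :: nat assume "k < 2 ^ p"
    with y[of k] show "\<epsilon> * norm (block_average d h' k - h k) \<le> block_average d (\<lambda>j. \<phi> (h' j)) k - \<phi> (h k) + \<eta>"
      using avg[of "\<lambda>x. x" k] avg[of \<phi> k] by (simp add: Y_def)
  qed (simp add: d_def)
qed

text \<open>If no such slice exists, \<open>bush_level\<close> can be iterated, with \<open>\<eta> = (1 / 2) ^ n\<close>
  at stage \<open>n\<close>. The errors are bounded by the increments of the means \<open>\<Phi> n\<close> of
  \<open>\<phi>\<close>, up to the factor \<open>1 / \<epsilon>\<close> and the numbers \<open>(1 / 2) ^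
  n\<close>; their sum telescopes and is finite as \<open>\<phi>\<close> is bounded. So the iterates form a
  quasi-martingale whose increments are at least \<open>\<delta> / 2\<close> everywhere, contrary to the
  Radon-Nikodym property.\<close>

theorem RNP_small_slice:
  fixes D :: "'a::banach set" and \<phi> :: "'a \<Rightarrow> real"
  assumes RNP: "radon_nikodym_property TYPE('a)" and D: "bounded D" "D \<noteq> {}" and \<phi>: "bounded (\<phi> ` D)"
    and pos: "0 < \<epsilon>" "0 < \<delta>"
  obtains y :: "'a \<Rightarrow>\<^sub>L real" and \<beta> where "norm y \<le> \<epsilon>" "\<exists>x\<in>D. \<beta> < \<phi> x + y x"
    "\<And>x z. x \<in> D \<Longrightarrow> z \<in> D \<Longrightarrow> \<beta> < \<phi> x + y x \<Longrightarrow> \<beta> < \<phi> z + y z \<Longrightarrow> dist x z < \<delta>"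
proof (rule ccontr)
  assume no: "\<not> thesis"
  note witness = that
  have no_slice: "\<exists>u\<in>D. \<exists>v\<in>D. \<beta> < \<phi> u + blinfun_apply y u \<and> \<beta> < \<phi> v + blinfun_apply y v \<and> \<delta> \<le> dist u v"
    if "norm y \<le> \<epsilon>" "\<exists>u\<in>D. \<beta> < \<phi> u + blinfun_apply y u" for y :: "'a \<Rightarrow>\<^sub>L real" and \<beta>
    using no witness[OF that] by (meson not_le)
  have step: "\<exists>d. \<forall>e\<ge>d. \<exists>y. (\<forall>j<2 ^ e. y j \<in> D \<and> \<delta> / 2 \<le> dist (y j) x) \<and>
      \<epsilon> * norm (block_average e y 0 - x) \<le> block_average e (\<lambda>j. \<phi> (y j)) 0 - \<phi> x + (1 / 2) ^ n"
    if x: "x \<in> D" for x and n :: nat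
  proof -
    have "0 < (1 / 2 :: real) ^ n" by simp
    then obtain d where "\<And>e. d \<le> e \<Longrightarrow> \<exists>y. (\<forall>j<2 ^ e. y j \<in> D \<and> \<delta> / 2 \<le> dist (y j) x) \<and>
      \<epsilon> * norm (block_average e y 0 - x) \<le> block_average e (\<lambda>j. \<phi> (y j)) 0 - \<phi> x + (1 / 2) ^ n"
      using bush_step[OF pos(1) _ x no_slice, where \<eta> = "(1 / 2) ^ n"] by blast
    then show ?thesis by blast
  qed
  define P :: "nat \<times> (nat \<Rightarrow> 'a) \<Rightarrow> bool" where "P = (\<lambda>(p, h). \<forall>k<2 ^ p. h k \<in> D)"
  define R where "R n = (\<lambda>(p, h) (p', h'). p < p' \<and> (\<forall>k<2 ^ p'. \<delta> / 2 \<le> dist (h' k) (h (k div 2 ^ (p' - p)))) \<and>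
    (\<forall>k<2 ^ p. \<epsilon> * norm (block_average (p' - p) h' k - h k)
      \<le> block_average (p' - p) (\<lambda>j. \<phi> (h' j)) k - \<phi> (h k) + (1 / 2) ^ n))"
    for n :: nat
  obtain x0 where "x0 \<in> D" using D(2) by blast
  have "\<exists>f. \<forall>n. P (f n) \<and> R n (f n) (f (Suc n))"
  proof (rule dependent_nat_choice)
    show "\<exists>ph. P ph"
      using \<open>x0 \<in> D\<close> by (intro exI[of _ "(0, \<lambda>_. x0)"]) (simp add: P_def)
    fix ph :: "nat \<times> (nat \<Rightarrow> 'a)" and n
    assume "P ph"
    then obtain p h where ph: "ph = (p, h)" "\<And>k. k < 2 ^ p \<Longrightarrow> h k \<in> D"
      by (cases ph) (auto simp: P_def)
    obtain d h' where "0 < d" "\<And>k. k < 2 ^ (p + d) \<Longrightarrow> h' k \<in> D"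
      "\<And>k. k < 2 ^ (p + d) \<Longrightarrow> \<delta> / 2 \<le> dist (h' k) (h (k div 2 ^ d))"
      "\<And>k. k < 2 ^ p \<Longrightarrow> \<epsilon> * norm (block_average d h' k - h k) \<le> block_average d (\<lambda>j. \<phi> (h' j)) k - \<phi> (h k) + (1 / 2) ^ n"
      by (rule bush_level[OF ph(2) step[of _ n]]) blast+
    then show "\<exists>ph'. P ph' \<and> R n ph ph'"
      by (intro exI[of _ "(p + d, h')"]) (simp add: P_def R_def ph(1))
  qed
  then obtain f where f: "\<And>n. P (f n)" "\<And>n. R n (f n) (f (Suc n))" by blast
  define m where "m n = fst (f n)" for n
  define X where "X n = snd (f n)" for n
  define e where "e n = m (Suc n) - m n" for n
  have X_D: "X n k \<in> D" if "k < 2 ^ m n" for n k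
    using f(1)[of n] that by (simp add: P_def m_def X_def split_beta)
  have m_less: "m n < m (Suc n)" for n
    using f(2)[of n] by (simp add: R_def m_def split_beta)
  have separated: "\<delta> / 2 \<le> norm (X (Suc n) k - X n (k div 2 ^ (m (Suc n) - m n)))" if "k < 2 ^ m (Suc n)" for n k
    using f(2)[of n] that by (simp add: R_def m_def X_def split_beta dist_norm)
  have drift: "\<epsilon> * norm (block_average (e n) (X (Suc n)) k - X n k)
      \<le> block_average (e n) (\<lambda>j. \<phi> (X (Suc n) j)) k - \<phi> (X n k) + (1 / 2) ^ n" if "k < 2 ^ m n" for n k
    using f(2)[of n] that by (simp add: R_def m_def X_def e_def split_beta)
  define \<Phi> where "\<Phi> n = (\<Sum>k<2 ^ m n. \<phi> (X n k)) / 2 ^ m n" for n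
  define err where "err n = (\<Phi> (Suc n) - \<Phi> n + (1 / 2) ^ n) / \<epsilon>" for n
  have err: "(\<Sum>k<2 ^ m n. norm (block_average (m (Suc n) - m n) (X (Suc n)) k - X n k)) / 2 ^ m n \<le> err n" for n
  proof -
    have "\<epsilon> * (\<Sum>k<2 ^ m n. norm (block_average (e n) (X (Suc n)) k - X n k))
        \<le> (\<Sum>k<2 ^ m n. block_average (e n) (\<lambda>j. \<phi> (X (Suc n) j)) k - \<phi> (X n k) + (1 / 2) ^ n)"
      unfolding sum_distrib_left by (intro sum_mono drift) simp
    also have "\<dots> = (\<Sum>k<2 ^ m n. block_average (e n) (\<lambda>j. \<phi> (X (Suc n) j)) k) - 2 ^ m n * \<Phi> n + 2 ^ m n * (1 / 2) ^ n"
      by (simp add: sum.distrib sum_subtractf \<Phi>_def)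
    also have "(\<Sum>k<2 ^ m n. block_average (e n) (\<lambda>j. \<phi> (X (Suc n) j)) k) = 2 ^ m n * \<Phi> (Suc n)"
    proof -
      have me: "m (Suc n) = m n + e n" using m_less[of n] by (simp add: e_def)
      have "(\<Sum>k<2 ^ m n. block_average (e n) (\<lambda>j. \<phi> (X (Suc n) j)) k)
          = (1 / 2 ^ e n) * (\<Sum>k<2 ^ m (Suc n). \<phi> (X (Suc n) k))"
        unfolding me sum_blocks[symmetric] by (simp add: block_average_def sum_distrib_left)
      then show ?thesis
        by (simp add: \<Phi>_def me power_add)
    qed
    finally show ?thesis
      using pos(1) by (simp add: err_def e_def field_simps)
  qed
  obtain K where K: "\<And>x. x \<in> D \<Longrightarrow> norm x \<le> K"
    using D(1) by (auto simp: bounded_iff)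
  obtain B where B: "\<And>x. x \<in> D \<Longrightarrow> \<bar>\<phi> x\<bar> \<le> B"
    using \<phi> by (auto simp: bounded_iff)
  have \<Phi>_le: "\<bar>\<Phi> n\<bar> \<le> B" for n
  proof -
    have "\<bar>\<Sum>k<2 ^ m n. \<phi> (X n k)\<bar> \<le> (\<Sum>k<(2::nat) ^ m n. B)"
      by (rule order_trans[OF sum_abs]) (intro sum_mono B X_D, simp)
    then show ?thesis by (simp add: \<Phi>_def field_simps abs_divide)
  qed
  have "summable err"
  proof (rule summableI_nonneg_bounded)
    show "0 \<le> err n" for n
      by (rule order_trans[OF _ err]) (simp add: sum_nonneg)
    fix n
    have "(\<Sum>i<n. err i) = (\<Phi> n - \<Phi> 0 + (\<Sum>i<n. (1 / 2) ^ i)) / \<epsilon>"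
      unfolding err_def sum_divide_distrib[symmetric] sum.distrib sum_lessThan_telescope ..
    also have "\<dots> \<le> (2 * B + 2) / \<epsilon>"
    proof (rule divide_right_mono)
      have "(\<Sum>i<n. (1 / 2 :: real) ^ i) \<le> 2"
        using geometric_sum_less[of "1 / 2 :: real" "{..<n}"] by simp
      then show "\<Phi> n - \<Phi> 0 + (\<Sum>i<n. (1 / 2) ^ i) \<le> 2 * B + 2"
        using \<Phi>_le[of n] \<Phi>_le[of 0] by linarith
    qed (use pos in simp)
    finally show "(\<Sum>i<n. err i) \<le> (2 * B + 2) / \<epsilon>" .
  qed
  then interpret cell_quasi_martingale m X K err
    using m_less X_D K err by unfold_locales (auto simp: strict_mono_Suc_iff)
  from pos have "0 < \<delta> / 2" by simp
  from RNP_increments_small[OF RNP this] obtain n where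
    n: "(\<Sum>k<2 ^ m (Suc n). norm (X (Suc n) k - X n (k div 2 ^ (m (Suc n) - m n)))) / 2 ^ m (Suc n) < \<delta> / 2"
    by blast
  have "(\<Sum>k<(2::nat) ^ m (Suc n). \<delta> / 2) \<le> (\<Sum>k<2 ^ m (Suc n). norm (X (Suc n) k - X n (k div 2 ^ (m (Suc n) - m n))))"
    by (intro sum_mono separated) simp
  with n show False
    by (simp add: field_simps)
qed

section \<open>Perturbing to attain a maximum\<close>

text \<open>The functionals \<open>y\<close> for which \<open>\<phi> + y\<close> has a slice of diameter less than
  \<open>1 / Suc n\<close> form an open set, which is dense by \<open>RNP_small_slice\<close> applied to the
  bounded functions \<open>\<phi> + y\<^sub>0\<close>. For \<open>y\<close> in all these sets every maximizing
  sequence of \<open>\<phi> + y\<close> is a Cauchy sequence, since it eventually enters each of the small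
  slices.\<close>

theorem Stegall_variational_principle:
  fixes D :: "'a::banach set" and \<phi> :: "'a \<Rightarrow> real"
  assumes RNP: "radon_nikodym_property TYPE('a)" and D: "closed D" "bounded D" "D \<noteq> {}"
    and \<phi>: "bounded (\<phi> ` D)" "continuous_on D \<phi>" and "0 < \<epsilon>"
  obtains y :: "'a \<Rightarrow>\<^sub>L real" and x0 where "norm y \<le> \<epsilon>" "x0 \<in> D" "\<And>x. x \<in> D \<Longrightarrow> \<phi> x + y x \<le> \<phi> x0 + y x0"
proof -
  obtain R where R: "0 < R" "\<And>x. x \<in> D \<Longrightarrow> norm x \<le> R"
    using D(2) bounded_pos by blast
  define small where "small y \<beta> d \<longleftrightarrow> (\<exists>x\<in>D. \<beta> < \<phi> x + blinfun_apply y x) \<and>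
    (\<forall>x\<in>D. \<forall>z\<in>D. \<beta> < \<phi> x + blinfun_apply y x \<longrightarrow> \<beta> < \<phi> z + blinfun_apply y z \<longrightarrow> dist x z < d)" for y \<beta> d
  define U where "U n = {y. \<exists>\<beta>. small y \<beta> (1 / real (Suc n))}" for n
  have bdd: "bounded ((\<lambda>x. \<phi> x + blinfun_apply y x) ` D)" for y
    by (intro bounded_plus_comp \<phi> bounded_linear_image[OF D(2)] blinfun.bounded_linear_right)
  have y_close: "\<bar>blinfun_apply y' x - blinfun_apply y x\<bar> \<le> norm (y' - y) * R" if "x \<in> D" for x y y'
  proof -
    have "\<bar>blinfun_apply y' x - blinfun_apply y x\<bar> \<le> norm (y' - y) * norm x"
      using norm_blinfun[of "y' - y" x] by (simp add: blinfun.diff_left)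
    also have "\<dots> \<le> norm (y' - y) * R"
      using R(2)[OF that] by (intro mult_left_mono) auto
    finally show ?thesis .
  qed
  have "open (U n)" for n
    unfolding open_dist
  proof
    fix y assume "y \<in> U n"
    then obtain \<beta> x where x: "x \<in> D" "\<beta> < \<phi> x + blinfun_apply y x"
      and diam: "\<forall>x\<in>D. \<forall>z\<in>D. \<beta> < \<phi> x + blinfun_apply y x \<longrightarrow> \<beta> < \<phi> z + blinfun_apply y z
        \<longrightarrow> dist x z < 1 / real (Suc n)"
      by (auto simp: U_def small_def)
    define \<gamma> where "\<gamma> = \<phi> x + blinfun_apply y x - \<beta>"
    have \<gamma>: "0 < \<gamma>" using x by (simp add: \<gamma>_def)
    have "y' \<in> U n" if "dist y' y < \<gamma> / (2 * R)" for y'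
    proof -
      have "norm (y' - y) * R < \<gamma> / 2"
        using that R(1) by (simp add: dist_norm field_simps)
      with y_close have close: "\<bar>blinfun_apply y' z - blinfun_apply y z\<bar> < \<gamma> / 2" if "z \<in> D" for z
        using that by (meson order_le_less_trans)
      have "small y' (\<beta> + \<gamma> / 2) (1 / real (Suc n))"
        unfolding small_def
      proof (intro conjI ballI impI)
        show "\<exists>x\<in>D. \<beta> + \<gamma> / 2 < \<phi> x + blinfun_apply y' x"
        proof
          show "\<beta> + \<gamma> / 2 < \<phi> x + blinfun_apply y' x"
            using close[OF x(1)] \<gamma>_def by linarith
        qed (rule x(1))
        fix u v assume uv: "u \<in> D" "v \<in> D" "\<beta> + \<gamma> / 2 < \<phi> u + blinfun_apply y' u"
          "\<beta> + \<gamma> / 2 < \<phi> v + blinfun_apply y' v"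
        with close[of u] close[of v] have "\<beta> < \<phi> u + blinfun_apply y u" "\<beta> < \<phi> v + blinfun_apply y v"
          by linarith+
        with diam uv show "dist u v < 1 / real (Suc n)" by blast
      qed
      then show ?thesis by (auto simp: U_def)
    qed
    then show "\<exists>e>0. \<forall>y'. dist y' y < e \<longrightarrow> y' \<in> U n"
      using \<gamma> R(1) by (intro exI[of _ "\<gamma> / (2 * R)"]) auto
  qed
  moreover have "closure (U n) = UNIV" for n
  proof -
    have "y0 \<in> closure (U n)" for y0
      unfolding closure_approachable
    proof (intro allI impI)
      fix e :: real assume "0 < e"
      then have "0 < e / 2" "0 < 1 / real (Suc n)" by auto
      then obtain y :: "'a \<Rightarrow>\<^sub>L real" and \<beta> where y: "norm y \<le> e / 2"
        "\<exists>x\<in>D. \<beta> < \<phi> x + blinfun_apply y0 x + blinfun_apply y x"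
        "\<And>x z. x \<in> D \<Longrightarrow> z \<in> D \<Longrightarrow> \<beta> < \<phi> x + blinfun_apply y0 x + blinfun_apply y x
          \<Longrightarrow> \<beta> < \<phi> z + blinfun_apply y0 z + blinfun_apply y z \<Longrightarrow> dist x z < 1 / real (Suc n)"
        using RNP_small_slice[OF RNP D(2,3) bdd[of y0]] by metis
      then have "y0 + y \<in> U n"
        by (auto simp: U_def small_def blinfun.add_left add.assoc intro!: exI[of _ \<beta>])
      moreover have "dist (y0 + y) y0 < e"
        using y(1) \<open>0 < e\<close> by (simp add: dist_norm)
      ultimately show "\<exists>y\<in>U n. dist y y0 < e" by blast
    qed
    then show ?thesis by blast
  qed
  ultimately have "closure (\<Inter>(range U)) = UNIV"
    using Met_TC.metric_Baire_category[of "range U"] by (auto simp: complete_UNIV)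
  then have "0 \<in> closure (\<Inter>(range U))" by simp
  then obtain y where y: "y \<in> \<Inter>(range U)" "dist y 0 < \<epsilon>"
    using \<open>0 < \<epsilon>\<close> unfolding closure_approachable by blast
  define \<psi> where "\<psi> x = \<phi> x + blinfun_apply y x" for x
  define s where "s = (SUP x\<in>D. \<psi> x)"
  have bdd_above: "bdd_above (\<psi> ` D)"
    unfolding \<psi>_def using bdd by (rule bounded_imp_bdd_above)
  have \<psi>_le: "\<psi> x \<le> s" if "x \<in> D" for x
    unfolding s_def using that bdd_above by (rule cSUP_upper)
  have "\<exists>x\<in>D. s - 1 / real (Suc k) < \<psi> x" for k
    using less_cSUP_iff[OF D(3) bdd_above, of "s - 1 / real (Suc k)"] by (simp add: s_def)
  then obtain x where x: "\<And>k. x k \<in> D" "\<And>k. s - 1 / real (Suc k) < \<psi> (x k)"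
    by metis
  have lim_s: "(\<lambda>k. s - 1 / real (Suc k)) \<longlonglongrightarrow> s"
    using tendsto_diff[OF tendsto_const[of s] LIMSEQ_inverse_real_of_nat] by (simp add: inverse_eq_divide)
  have "Cauchy x"
    unfolding metric_Cauchy_iff2
  proof
    fix n
    from y(1) have "y \<in> U n" by blast
    then obtain \<beta> where \<beta>: "small y \<beta> (1 / real (Suc n))" by (auto simp: U_def)
    then obtain x1 where "x1 \<in> D" "\<beta> < \<psi> x1" by (auto simp: small_def \<psi>_def)
    with \<psi>_le have "\<beta> < s" by (meson order_less_le_trans)
    with lim_s have "eventually (\<lambda>k. \<beta> < s - 1 / real (Suc k)) sequentially"
      by (rule order_tendstoD)
    then obtain N where N: "\<And>k. N \<le> k \<Longrightarrow> \<beta> < s - 1 / real (Suc k)"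
      by (auto simp: eventually_sequentially)
    then have big: "\<beta> < \<psi> (x k)" if "N \<le> k" for k
      using x(2)[of k] that by (meson order_less_trans)
    have "dist (x m) (x k) < inverse (real (Suc n))" if "N \<le> m" "N \<le> k" for m k
      using \<beta> big[OF that(1)] big[OF that(2)] x(1) unfolding small_def \<psi>_def
      by (simp add: inverse_eq_divide)
    then show "\<exists>M. \<forall>m\<ge>M. \<forall>n'\<ge>M. dist (x m) (x n') < inverse (real (Suc n))"
      by blast
  qed
  then obtain x0 where x0: "x \<longlonglongrightarrow> x0"
    using Cauchy_convergent convergent_def by blast
  with x(1) D(1) have "x0 \<in> D"
    by (metis closed_sequentially)
  moreover have "continuous_on D \<psi>"
    unfolding \<psi>_def by (intro continuous_intros \<phi>)
  ultimately have "(\<lambda>k. \<psi> (x k)) \<longlonglongrightarrow> \<psi> x0"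
    using x0 x(1) by (intro continuous_on_tendsto_compose[of D \<psi>]) auto
  then have "s \<le> \<psi> x0"
    using lim_s x(2) by (intro LIMSEQ_le[of "\<lambda>k. s - 1 / real (Suc k)" s "\<lambda>k. \<psi> (x k)"]) (auto intro: less_imp_le)
  with \<psi>_le have "\<psi> z \<le> \<psi> x0" if "z \<in> D" for z
    using that by (meson order_trans)
  with \<open>x0 \<in> D\<close> y(2) show ?thesis
    by (intro that[of y x0]) (auto simp: \<psi>_def)
qed

section \<open>Functionals over the scalar field\<close>

text \<open>\<open>re\<close> is the real part. The two alternatives say that the scalars are the real numbers, or that
  they contain an imaginary unit \<open>j\<close>, in which case the imaginary part of \<open>c\<close> is
  \<open>- re (j * c)\<close>.\<close>

lemma real_or_complex_Re:
  obtains re :: "'k::real_or_complex \<Rightarrow> real"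
  where "linear re" "\<And>r. re (of_real r) = r" "\<And>c. \<bar>re c\<bar> \<le> norm c"
    "(\<forall>c. c = of_real (re c)) \<or> (\<exists>j. j * j = -1 \<and> re j = 0 \<and> (\<forall>c. c = of_real (re c) - j * of_real (re (j * c))))"
proof -
  obtain \<phi> :: "'k \<Rightarrow> complex" where \<phi>: "\<And>x y. \<phi> (x + y) = \<phi> x + \<phi> y"
    "\<And>r x. \<phi> (r *\<^sub>R x) = r *\<^sub>R \<phi> x" "\<And>x y. \<phi> (x * y) = \<phi> x * \<phi> y" "\<And>x. norm (\<phi> x) = norm x"
    using complex_embedding[where 'a = 'k] by blast
  have lin: "linear \<phi>"
    using \<phi> by (intro linearI)
  have inj: "x = y" if "\<phi> x = \<phi> y" for x y
    using linear_diff[OF lin, of x y] \<phi>(4)[of "x - y"] that by simp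
  have one: "\<phi> 1 = 1"
  proof -
    have "\<phi> 1 * \<phi> 1 = \<phi> 1" using \<phi>(3)[of 1 1] by simp
    moreover have "\<phi> 1 \<noteq> 0" using \<phi>(4)[of 1] by (metis norm_one norm_zero zero_neq_one)
    ultimately show ?thesis by simp
  qed
  have of_real: "\<phi> (of_real r) = of_real r" for r
    using \<phi>(2)[of r 1] one by (simp add: of_real_def)
  show ?thesis
  proof (rule that[of "\<lambda>c. Re (\<phi> c)"])
    show "linear (\<lambda>c. Re (\<phi> c))"
      using \<phi> by (intro linearI) auto
    show "Re (\<phi> (of_real r)) = r" for r
      by (simp add: of_real)
    show "\<bar>Re (\<phi> c)\<bar> \<le> norm c" for c
      using abs_Re_le_cmod[of "\<phi> c"] \<phi>(4)[of c] by simp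
    show "(\<forall>c. c = of_real (Re (\<phi> c))) \<or>
      (\<exists>j. j * j = -1 \<and> Re (\<phi> j) = 0 \<and> (\<forall>c. c = of_real (Re (\<phi> c)) - j * of_real (Re (\<phi> (j * c)))))"
    proof (cases "\<exists>j. \<phi> j = \<i>")
      case True
      then obtain j where j: "\<phi> j = \<i>" by blast
      have "j * j = -1"
        by (rule inj) (simp add: \<phi> j linear_neg[OF lin] one)
      moreover have "c = of_real (Re (\<phi> c)) - j * of_real (Re (\<phi> (j * c)))" for c
        by (rule inj) (simp add: \<phi> j linear_diff[OF lin] of_real complex_eq_iff)
      ultimately show ?thesis using j by (intro disjI2 exI[of _ j]) simp
    next
      case False
      have "c = of_real (Re (\<phi> c))" for c
      proof (rule ccontr)
        assume neq: "c \<noteq> of_real (Re (\<phi> c))"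
        have im: "Im (\<phi> c) \<noteq> 0"
        proof
          assume "Im (\<phi> c) = 0"
          then have "\<phi> c = \<phi> (of_real (Re (\<phi> c)))"
            by (simp add: of_real complex_eq_iff)
          with inj neq show False by blast
        qed
        have "\<phi> ((1 / Im (\<phi> c)) *\<^sub>R (c - of_real (Re (\<phi> c)))) = \<i>"
          using im by (simp add: \<phi> linear_diff[OF lin] of_real complex_eq_iff)
        with False show False by blast
      qed
      then show ?thesis by blast
    qed
  qed
qed

text \<open>The functional \<open>F\<close> with real part \<open>y\<close>, in the complex case \<open>F x = y x - j y (j
  x)\<close>. Rotating \<open>x\<close> by a unimodular scalar makes \<open>F x\<close> real and nonnegative, so
  both functionals have the same norm.\<close>

lemma bounded_functional_over_scalars:
  fixes smul :: "'k::real_or_complex \<Rightarrow> 'a::real_normed_vector \<Rightarrow> 'a" and y :: "'a \<Rightarrow> real"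
  assumes V: "normed_space_over smul" and y: "linear y" and e: "\<And>x. \<bar>y x\<bar> \<le> e * norm x"
  obtains F where "Vector_Spaces.linear smul (*) F" "\<And>x. norm (F x) \<le> e * norm x"
    "\<And>x. y x \<le> norm (F x)" "\<And>x. \<exists>c. norm c = 1 \<and> y (smul c x) = norm (F x)"
proof -
  interpret V: normed_space_over smul by fact
  interpret field: vector_space "(*) :: 'k \<Rightarrow> 'k \<Rightarrow> 'k"
    by unfold_locales (simp_all add: algebra_simps)
  obtain re :: "'k \<Rightarrow> real" where re: "linear re" "\<And>r. re (of_real r) = r" "\<And>c. \<bar>re c\<bar> \<le> norm c"
    and alt: "(\<forall>c. c = of_real (re c)) \<or> (\<exists>j. j * j = -1 \<and> re j = 0 \<and> (\<forall>c. c = of_real (re c) - j * of_real (re (j * c))))"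
    using real_or_complex_Re by blast
  have y_add: "y (u + v) = y u + y v" and y_scale: "y (smul (of_real r) v) = r * y v" for u v r
    using linear_add[OF y] linear_scale[OF y] by (simp_all add: V.smul_of_real)
  have "\<exists>F. Vector_Spaces.linear smul (*) F \<and> (\<forall>x. re (F x) = y x)"
    using alt
  proof (elim disjE exE conjE)
    assume real: "\<forall>c :: 'k. c = of_real (re c)"
    have "of_real (y (smul c x)) = c * of_real (y x)" for c x
    proof -
      obtain r where "c = of_real r" using real by blast
      then show ?thesis by (simp add: y_scale)
    qed
    then have "Vector_Spaces.linear smul (*) (\<lambda>x. of_real (y x) :: 'k)"
      by unfold_locales (simp_all add: y_add)
    with re show ?thesis by (intro exI[of _ "\<lambda>x. of_real (y x)"]) simp
  next
    fix j :: 'k assume j: "j * j = -1" "re j = 0" and split: "\<forall>c. c = of_real (re c) - j * of_real (re (j * c))"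
    define F where "F x = of_real (y x) - j * of_real (y (smul j x))" for x
    have F_add: "F (u + v) = F u + F v" for u v
      by (simp add: F_def y_add V.scale_right_distrib algebra_simps)
    have F_real: "F (smul (of_real r) x) = of_real r * F x" for r x
    proof -
      have comm: "smul j (smul (of_real r) x) = smul (of_real r) (smul j x)"
        by (simp add: mult.commute)
      show ?thesis
        unfolding F_def comm y_scale by (simp add: algebra_simps)
    qed
    have F_j: "F (smul j x) = j * F x" for x
    proof -
      have "y (smul j (smul j x)) = - y x"
        using linear_neg[OF y, of x] j by simp
      then show ?thesis
        using j by (simp add: F_def algebra_simps flip: mult.assoc)
    qed
    have F_scale: "F (smul c x) = c * F x" for c x
    proof -
      obtain a b where c: "c = of_real a + of_real b * j"
      proof
        show "c = of_real (re c) + of_real (- re (j * c)) * j"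
          using split[rule_format, of c] by (simp add: algebra_simps)
      qed
      have "F (smul c x) = F (smul (of_real a) x) + F (smul (of_real b) (smul j x))"
        by (simp add: c V.scale_left_distrib F_add)
      also have "\<dots> = c * F x"
        unfolding F_real F_j by (simp add: c algebra_simps)
      finally show ?thesis .
    qed
    have "Vector_Spaces.linear smul (*) F"
      by unfold_locales (simp_all add: F_add F_scale)
    moreover have "re (F x) = y x" for x
    proof -
      have "re (j * of_real r) = 0" for r
        using linear_scale[OF re(1), of r j] j by (simp add: scaleR_conv_of_real mult.commute)
      then show ?thesis
        by (simp add: F_def linear_diff[OF re(1)] re)
    qed
    ultimately show ?thesis by blast
  qed
  then obtain F where F: "Vector_Spaces.linear smul (*) F" and re_F: "\<And>x. re (F x) = y x"
    by blast
  have rot: "\<exists>c. norm c = 1 \<and> y (smul c x) = norm (F x)" for x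
  proof (cases "F x = 0")
    case True
    then show ?thesis
      using re_F[of x] linear_0[OF re(1)] by (intro exI[of _ 1]) simp
  next
    case False
    define c where "c = of_real (norm (F x)) / F x"
    have "y (smul c x) = re (c * F x)"
      unfolding re_F[symmetric] using F by (simp add: linear_iff Vector_Spaces.linear_iff)
    with False re(2) have "y (smul c x) = norm (F x)"
      by (simp add: c_def)
    moreover have "norm c = 1"
      using False by (simp add: c_def norm_divide)
    ultimately show ?thesis by (intro exI[of _ c]) simp
  qed
  show ?thesis
  proof (rule that[OF F])
    show "norm (F x) \<le> e * norm x" for x
    proof -
      obtain c where c: "norm c = 1" "y (smul c x) = norm (F x)"
        using rot by blast
      then show ?thesis
        using e[of "smul c x"] by (simp add: V.norm_smul)
    qed
    show "y x \<le> norm (F x)" for x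
      using re(3)[of "F x"] re_F by simp
  qed (rule rot)
qed

section \<open>Operators attaining their supremum\<close>

text \<open>Let \<open>norm (T x) + y x\<close> be largest at \<open>x\<^sub>0\<close>, and let \<open>F\<close> have real
  part \<open>y\<close>. As \<open>D\<close> is balanced, \<open>norm (T x) + norm (F x)\<close> is largest at
  \<open>x\<^sub>0\<close> as well. This sum bounds the norm of \<open>S x = T x + (c\<^sub>0 * F x) u\<close>,
  for unimodular \<open>c\<^sub>0\<close> and a unit vector \<open>u\<close>, and the bound is attained at
  \<open>x\<^sub>0\<close> when \<open>T x\<^sub>0\<close> is a nonnegative multiple of \<open>u\<close> and
  \<open>c\<^sub>0 * F x\<^sub>0\<close> is nonnegative.\<close>

theorem norm_attaining_perturbation:
  fixes scaleX :: "'k::real_or_complex \<Rightarrow> 'a::banach \<Rightarrow> 'a" and scaleY :: "'k \<Rightarrow> 'b::real_normed_vector \<Rightarrow> 'b"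
  assumes X: "normed_space_over scaleX" and Y: "normed_space_over scaleY"
    and RNP: "radon_nikodym_property TYPE('a)"
    and D: "closed D" "bounded D" "D \<noteq> {}" and balanced: "\<And>c x. norm c \<le> 1 \<Longrightarrow> x \<in> D \<Longrightarrow> scaleX c x \<in> D"
    and T: "T \<in> bounded_operators scaleX scaleY" and "0 < \<epsilon>"
  obtains S where "S \<in> bounded_operators scaleX scaleY" "norm (S - T) \<le> \<epsilon>" "attains_supremum_on S D"
proof (cases "T = 0")
  case True
  then have "attains_supremum_on T D"
    using D(3) by (auto simp: attains_supremum_on_def)
  with T \<open>0 < \<epsilon>\<close> show ?thesis by (intro that[of T]) auto
next
  case False
  interpret X: normed_space_over scaleX by fact
  interpret Y: normed_space_over scaleY by fact
  interpret T: Vector_Spaces.linear scaleX scaleY "blinfun_apply T"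
    using T by (simp add: bounded_operators_def)
  define \<phi> where "\<phi> x = norm (blinfun_apply T x)" for x
  have "bounded (\<phi> ` D)"
    using bounded_linear_image[OF D(2) blinfun.bounded_linear_right[of T]]
    unfolding \<phi>_def bounded_iff by auto
  moreover have "continuous_on D \<phi>"
    unfolding \<phi>_def by (intro continuous_intros)
  ultimately obtain y :: "'a \<Rightarrow>\<^sub>L real" and x0 where y: "norm y \<le> \<epsilon>" and x0: "x0 \<in> D"
    and max: "\<And>x. x \<in> D \<Longrightarrow> \<phi> x + blinfun_apply y x \<le> \<phi> x0 + blinfun_apply y x0"
    using Stegall_variational_principle[OF RNP D _ _ \<open>0 < \<epsilon>\<close>] by blast
  have "linear (blinfun_apply y)" "\<And>x. \<bar>blinfun_apply y x\<bar> \<le> \<epsilon> * norm x"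
    using y norm_blinfun[of y] mult_right_mono[OF y norm_ge_zero]
    by (auto intro!: bounded_linear.linear blinfun.bounded_linear_right intro: order_trans[where y = "norm y * _"])
  then obtain F where F: "Vector_Spaces.linear scaleX (*) F" "\<And>x. norm (F x) \<le> \<epsilon> * norm x"
    "\<And>x. blinfun_apply y x \<le> norm (F x)"
    "\<And>x. \<exists>c. norm c = 1 \<and> blinfun_apply y (scaleX c x) = norm (F x)"
    using bounded_functional_over_scalars[OF X] by blast
  interpret F: Vector_Spaces.linear scaleX "(*)" F by fact
  have max_F: "\<phi> x + norm (F x) \<le> \<phi> x0 + norm (F x0)" if x: "x \<in> D" for x
  proof -
    obtain c where c: "norm c = 1" "blinfun_apply y (scaleX c x) = norm (F x)"
      using F(4) by blast
    have "\<phi> (scaleX c x) = \<phi> x"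
      using c by (simp add: \<phi>_def T.scale Y.norm_smul)
    with c max[OF balanced[of c x]] x F(3)[of x0] show ?thesis by simp
  qed
  \<comment> \<open>If \<open>T x0 = 0\<close> any unit vector serves; there is one because \<open>T \<noteq> 0\<close>.\<close>
  obtain u where u: "norm u = 1" "blinfun_apply T x0 = norm (blinfun_apply T x0) *\<^sub>R u"
  proof (cases "blinfun_apply T x0 = 0")
    case True
    from False obtain z where "blinfun_apply T z \<noteq> 0"
      by (metis blinfun_eqI zero_blinfun.rep_eq)
    with True show ?thesis
      by (intro that[of "sgn (blinfun_apply T z)"]) (auto simp: norm_sgn)
  next
    case False
    then show ?thesis
      by (intro that[of "sgn (blinfun_apply T x0)"]) (auto simp: norm_sgn sgn_div_norm)
  qed
  obtain c0 where c0: "norm c0 = 1" "c0 * F x0 = of_real (norm (F x0))"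
  proof (cases "F x0 = 0")
    case False
    then show ?thesis
      by (intro that[of "of_real (norm (F x0)) / F x0"]) (auto simp: norm_divide)
  qed (auto intro: that[of 1])
  define P where "P x = scaleY (c0 * F x) u" for x
  have norm_P: "norm (P x) = norm (F x)" for x
    using c0 u by (simp add: P_def Y.norm_smul norm_mult)
  have P: "Vector_Spaces.linear scaleX scaleY P"
    by unfold_locales (simp_all add: P_def F.add F.scale Y.scale_left_distrib distrib_left mult_ac)
  then interpret P: Vector_Spaces.linear scaleX scaleY P .
  have bl: "bounded_linear P"
  proof (rule bounded_linear_intro)
    show "P (r *\<^sub>R x) = r *\<^sub>R P x" for r x
      using P.scale[of "of_real r" x] by (simp add: X.smul_of_real Y.smul_of_real)
    show "norm (P x) \<le> norm x * \<epsilon>" for x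
      using F(2)[of x] by (simp add: norm_P mult.commute)
  qed (rule P.add)
  define S where "S = T + Blinfun P"
  have S: "blinfun_apply S x = blinfun_apply T x + P x" for x
    by (simp add: S_def blinfun.add_left bounded_linear_Blinfun_apply[OF bl])
  show ?thesis
  proof (rule that[of S])
    have "Vector_Spaces.linear scaleX scaleY (\<lambda>x. blinfun_apply T x + P x)"
      by unfold_locales (simp_all add: T.add T.scale P.add P.scale Y.scale_right_distrib)
    moreover have "blinfun_apply S = (\<lambda>x. blinfun_apply T x + P x)"
      using S by (rule ext)
    ultimately show "S \<in> bounded_operators scaleX scaleY"
      by (simp only: bounded_operators_def mem_Collect_eq)
    show "norm (S - T) \<le> \<epsilon>"
      unfolding S_def using F(2) \<open>0 < \<epsilon>\<close>
      by (intro norm_blinfun_bound) (auto simp: bounded_linear_Blinfun_apply[OF bl] norm_P)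
    have x0_val: "norm (blinfun_apply S x0) = \<phi> x0 + norm (F x0)"
    proof -
      have "P x0 = norm (F x0) *\<^sub>R u"
        by (simp add: P_def c0 Y.smul_of_real)
      then have "blinfun_apply S x0 = (\<phi> x0 + norm (F x0)) *\<^sub>R u"
        using u(2) by (simp add: S \<phi>_def scaleR_add_left)
      then show ?thesis
        using u(1) by (simp add: \<phi>_def)
    qed
    have "norm (blinfun_apply S x) \<le> norm (blinfun_apply S x0)" if "x \<in> D" for x
      using max_F[OF that] norm_triangle_ineq[of "blinfun_apply T x" "P x"]
      unfolding x0_val by (simp add: S norm_P \<phi>_def)
    then have "norm (blinfun_apply S x0) = (SUP x\<in>D. norm (blinfun_apply S x))"
      using x0 by (intro cSup_eq_maximum[symmetric]) auto
    with x0 show "attains_supremum_on S D"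
      by (auto simp: attains_supremum_on_def)
  qed
qed

theorem theorem4p21:
  fixes scaleX :: "'k::real_or_complex \<Rightarrow> 'a::banach \<Rightarrow> 'a"
    and G :: "('a \<Rightarrow>\<^sub>L 'a) set"
  assumes "normed_space_over scaleX"
    and "radon_nikodym_property TYPE('a)"
    and "isometry_group scaleX G"
    and "compact G"
  shows "G_bishop_phelps_property scaleX G TYPE('b::banach)"
  unfolding G_bishop_phelps_property_def
proof (intro allI impI subsetI)
  fix scaleY :: "'k \<Rightarrow> 'b \<Rightarrow> 'b" and C T
  assume Y: "normed_space_over scaleY" and C: "C \<noteq> {}" "closed C" "absolutely_convex scaleX C" "bounded C"
    and inv_C: "invariant_set G C" and T: "T \<in> invariant_operators scaleX scaleY G"
  interpret X: normed_space_over scaleX by fact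
  obtain Q where Q: "Q \<in> closure (convex hull G)" and Qg: "\<And>g. g \<in> G \<Longrightarrow> Q o\<^sub>L g = Q"
    using averaging_operator[OF assms(4,3)] by blast
  have "id_blinfun \<in> G" and G_lin: "G \<subseteq> bounded_operators scaleX scaleX"
    and G_iso: "\<And>g x. g \<in> G \<Longrightarrow> norm (blinfun_apply g x) = norm x"
    using assms(3) by (auto simp: isometry_group_def operator_group_def)
  \<comment> \<open>\<open>Q\<close> inherits from \<open>G\<close> every property that defines a closed convex set of operators.\<close>
  have Q_in: "Q \<in> W" if "closed W" "convex W" "G \<subseteq> W" for W
    using Q closure_minimal[OF hull_minimal[of G W convex, OF that(3,2)] that(1)] by blast
  have convexI_C: "a *\<^sub>R x + b *\<^sub>R z \<in> C" if "x \<in> C" "z \<in> C" "0 \<le> a" "0 \<le> b" "a + b = 1" for a b x z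
    using C(3) that unfolding absolutely_convex_def
    by (metis X.smul_of_real abs_of_nonneg norm_of_real order_refl)
  have balanced_C: "scaleX c x \<in> C" if "norm c \<le> 1" "x \<in> C" for c x
  proof -
    have "scaleX c x + scaleX 0 x \<in> C"
      using C(3) that unfolding absolutely_convex_def by (metis add.right_neutral norm_zero)
    then show ?thesis by simp
  qed
  have ev: "continuous_on UNIV (\<lambda>A :: 'a \<Rightarrow>\<^sub>L 'a. blinfun_apply A x)" for x
    by (intro continuous_intros)
  have Q_scale: "blinfun_apply Q (scaleX c x) = scaleX c (blinfun_apply Q x)" for c x
  proof -
    have comm: "scaleX c (r *\<^sub>R z) = r *\<^sub>R scaleX c z" for r z
      by (simp add: mult.commute flip: X.smul_of_real)
    have bl: "bounded_linear (scaleX c)"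
      by (rule bounded_linear_intro[where K = "norm c"])
        (simp_all add: X.scale_right_distrib comm X.norm_smul)
    have "Q \<in> {A. blinfun_apply A (scaleX c x) = scaleX c (blinfun_apply A x)}"
    proof (rule Q_in)
      show "closed {A. blinfun_apply A (scaleX c x) = scaleX c (blinfun_apply A x)}"
        by (intro closed_Collect_eq continuous_intros bounded_linear.continuous_on[OF bl])
      show "convex {A. blinfun_apply A (scaleX c x) = scaleX c (blinfun_apply A x)}"
        by (auto intro!: convexI simp: blinfun.add_left blinfun.scaleR_left X.scale_right_distrib comm)
      show "G \<subseteq> {A. blinfun_apply A (scaleX c x) = scaleX c (blinfun_apply A x)}"
        using G_lin by (auto simp: bounded_operators_def Vector_Spaces.linear_iff)
    qed
    then show ?thesis by simp
  qed
  then have Q_lin: "Q \<in> bounded_operators scaleX scaleX"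
    by (auto simp: bounded_operators_def Vector_Spaces.linear_iff X.vector_space_axioms blinfun.add_right)
  have Q_norm: "norm Q \<le> 1"
  proof -
    have "Q \<in> cball 0 1"
      using G_iso by (intro Q_in) (auto intro!: norm_blinfun_bound)
    then show ?thesis by simp
  qed
  have Q_C: "blinfun_apply Q x \<in> C" if "x \<in> C" for x
  proof -
    have "Q \<in> {A. blinfun_apply A x \<in> C}"
    proof (rule Q_in)
      show "closed {A. blinfun_apply A x \<in> C}"
        using closed_vimage[OF C(2) ev] by (simp add: vimage_def)
      show "convex {A. blinfun_apply A x \<in> C}"
        by (auto intro!: convexI simp: blinfun.add_left blinfun.scaleR_left convexI_C)
      show "G \<subseteq> {A. blinfun_apply A x \<in> C}"
        using inv_C that by (auto simp: invariant_set_def)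
    qed
    then show ?thesis by simp
  qed
  have fixed_by_Q: "blinfun_apply S (blinfun_apply Q x) = blinfun_apply S x"
    if "\<And>g x. g \<in> G \<Longrightarrow> blinfun_apply S (blinfun_apply g x) = blinfun_apply S x"
    for S :: "'a \<Rightarrow>\<^sub>L 'c::real_normed_vector" and x
  proof -
    have "Q \<in> {A. blinfun_apply S (blinfun_apply A x) = blinfun_apply S x}"
    proof (rule Q_in)
      show "closed {A :: 'a \<Rightarrow>\<^sub>L 'a. blinfun_apply S (blinfun_apply A x) = blinfun_apply S x}"
        by (intro closed_Collect_eq continuous_intros)
      show "convex {A :: 'a \<Rightarrow>\<^sub>L 'a. blinfun_apply S (blinfun_apply A x) = blinfun_apply S x}"
        by (auto intro!: convexI simp: blinfun.add_left blinfun.scaleR_left blinfun.add_right blinfun.scaleR_right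
            simp flip: scaleR_add_left)
    qed (use that in auto)
    then show ?thesis by simp
  qed
  have Qg': "blinfun_apply Q (blinfun_apply g x) = blinfun_apply Q x" if "g \<in> G" for g x
    using Qg[OF that] by (metis blinfun_apply_blinfun_compose)
  note QQ = fixed_by_Q[of Q, OF Qg']
  have T_lin: "T \<in> bounded_operators scaleX scaleY"
    and TQ: "\<And>x. blinfun_apply T (blinfun_apply Q x) = blinfun_apply T x"
    using T fixed_by_Q[of T] by (auto simp: invariant_operators_def)
  define D where "D = blinfun_apply Q ` C"
  \<comment> \<open>\<open>Q\<close> is a projection, so \<open>D\<close> consists of the fixed points of \<open>Q\<close> in \<open>C\<close> and is closed.\<close>
  have D_eq: "D = C \<inter> {x. blinfun_apply Q x = x}"
    using Q_C QQ by (force simp: D_def)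
  have "closed D"
    unfolding D_eq by (intro closed_Int C(2) closed_Collect_eq continuous_intros)
  moreover have "bounded D"
    using C(4) by (auto simp: D_eq intro: bounded_subset)
  moreover have "D \<noteq> {}"
    using C(1) by (simp add: D_def)
  moreover have "scaleX c x \<in> D" if "norm c \<le> 1" "x \<in> D" for c x
    using that balanced_C Q_lin by (auto simp: D_eq bounded_operators_def Vector_Spaces.linear_iff)
  ultimately have perturb: "\<exists>S. S \<in> bounded_operators scaleX scaleY \<and> norm (S - T) \<le> e \<and> attains_supremum_on S D"
    if "0 < e" for e
    using norm_attaining_perturbation[OF assms(1) Y assms(2) _ _ _ _ T_lin that] by metis
  show "T \<in> closure {S \<in> invariant_operators scaleX scaleY G. attains_supremum_on S C}"
    unfolding closure_approachable
  proof (intro allI impI)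
    fix e :: real assume "0 < e"
    then obtain S where S: "S \<in> bounded_operators scaleX scaleY" "norm (S - T) \<le> e / 2" "attains_supremum_on S D"
      using perturb[of "e / 2"] by auto
    have "S o\<^sub>L Q \<in> bounded_operators scaleX scaleY"
      using S(1) Q_lin by (auto simp: bounded_operators_def Vector_Spaces.linear_iff)
    then have "S o\<^sub>L Q \<in> invariant_operators scaleX scaleY G"
      by (simp add: invariant_operators_def Qg')
    moreover have "attains_supremum_on (S o\<^sub>L Q) C"
      using S(3) by (auto simp: attains_supremum_on_def D_def image_image)
    moreover have "dist (S o\<^sub>L Q) T < e"
    proof -
      have "(S o\<^sub>L Q) - T = (S - T) o\<^sub>L Q"
        by (rule blinfun_eqI) (simp add: blinfun.diff_left TQ)
      then have "norm ((S o\<^sub>L Q) - T) \<le> norm (S - T) * norm Q"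
        by (simp add: norm_blinfun_compose)
      also have "\<dots> \<le> norm (S - T)"
        using Q_norm by (simp add: mult_left_le)
      finally show ?thesis
        using S(2) \<open>0 < e\<close> by (simp add: dist_norm)
    qed
    ultimately show "\<exists>S\<in>{S \<in> invariant_operators scaleX scaleY G. attains_supremum_on S C}. dist S T < e"
      by blast
  qed
qed

end
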